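(* Let $1\le n\le 3$, $0<\alpha\le 1$, $\rho_\pm>0$ and $u_-<u_+$. For $A,B>0$ with $(\rho_+,u_+)\in R_1R_2^{AB}(\rho_-,u_-)$, let $(\rho^{AB},u^{AB})$ be the two-rarefaction-wave Riemann solution of the extended Chaplygin gas equations with Riemann data $(\rho_\pm,u_\pm)$. Then, as $A,B\to0$, the limit of the Riemann solution $(\rho^{AB},u^{AB})$ is two contact discontinuities connecting the constant states $(\rho_\pm,u_\pm)$ and the intermediate vacuum state, as follows (with $\xi=x/t$): $$(\rho,u)(\xi)=\begin{cases}(\rho_-,u_-), & -\infty<\xi\le u_-,\\ (0,\xi), & u_-<\xi<u_+,\\ (\rho_+,u_+), & u_+\le\xi<\infty,\end{cases}$$ which is exactly the Riemann solution to the transport equations $\rho_t+(\rho u)_x=0$, $(\rho u)_t+(\rho u^2)_x=0$ with the same Riemann data $(\rho_\pm,u_\pm)$.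
   Context: For $A,B>0$, the extended Chaplygin gas equations are $\rho_t+(\rho u)_x=0$, $(\rho u)_t+(\rho u^2+P)_x=0$ with $P=A\rho^n-B\rho^{-\alpha}$; Riemann data means $(\rho,u)(x,0)=(\rho_\pm,u_\pm)$ for $\pm x>0$. Put $c_{AB}(\rho)=\sqrt{An\rho^{n-1}+\alpha B\rho^{-\alpha-1}}$. The region $R_1R_2^{AB}(\rho_-,u_-)$ is the set of $(\rho,u)$, $\rho>0$, with $u-u_->\big|\int_{\rho_-}^{\rho}\frac{c_{AB}(s)}{s}ds\big|$ (the part of the phase plane where the Riemann solution consists of a 1-rarefaction wave followed by a 2-rarefaction wave). If $u_-<u_+$ it contains $(\rho_+,u_+)$ for all sufficiently small $A,B>0$. For $(\rho_+,u_+)$ in this region, the two-rarefaction-wave Riemann solution is the self-similar solution (a function of $\xi=x/t$) consisting, from left to right, of: the constant state $(\rho_-,u_-)$; the 1-rarefaction wave $\xi=u-c_{AB}(\rho)$, $u-u_-=-\int_{\rho_-}^{\rho}\frac{c_{AB}(s)}{s}ds$, $\rho_*^{AB}\le\rho\le\rho_-$; the constant state $(\rho_*^{AB},u_*^{AB})$; the 2-rarefaction wave $\xi=u+c_{AB}(\rho)$, $u_+-u=\int_{\rho}^{\rho_+}\frac{c_{AB}(s)}{s}ds$, $\rho_*^{AB}\le\rho\le\rho_+$; the constant state $(\rho_+,u_+)$. Here $\rho_*^{AB}$ is determined by $u_+-u_-=\int_{\rho_*^{AB}}^{\rho_-}\frac{c_{AB}(s)}{s}ds+\int_{\rho_*^{AB}}^{\rho_+}\frac{c_{AB}(s)}{s}ds$.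 "$A,B\to0$" means $(A,B)\to(0,0)$ with $A,B>0$.
   Formalization: The limit is pointwise for ξ≠u_±, for (ρ,ρu), and for u only where the limit density is nonzero: in the vacuum u^{AB} does not tend to ξ (for n>1 it tends to (u_-+u_+)/2 on an interval), and at ξ=u_± the printed values need not be limits. *)

theory Defs
  imports "HOL-Analysis.Analysis"
begin

definition sound_speed :: "real \<Rightarrow> real \<Rightarrow> real \<Rightarrow> real \<Rightarrow> real \<Rightarrow> real" where
  "sound_speed n \<alpha> A B \<rho> = sqrt (A * n * \<rho> powr (n - 1) + \<alpha> * B * \<rho> powr (- \<alpha> - 1))"

text \<open>The interval integral is oriented: its sign changes when the two bounds are exchanged.\<close>

definition wave_integral :: "real \<Rightarrow> real \<Rightarrow> real \<Rightarrow> real \<Rightarrow> real \<Rightarrow> real \<Rightarrow> real" where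
  "wave_integral n \<alpha> A B a b = (LBINT s=a..b. sound_speed n \<alpha> A B s / s)"

definition R1R2 :: "real \<Rightarrow> real \<Rightarrow> real \<Rightarrow> real \<Rightarrow> real \<Rightarrow> real \<Rightarrow> (real \<times> real) set" where
  "R1R2 n \<alpha> A B \<rho>m um =
    {(\<rho>, u). \<rho> > 0 \<and> u - um > \<bar>wave_integral n \<alpha> A B \<rho>m \<rho>\<bar>}"

text \<open>
  The profiles \<open>\<rho>\<close> and \<open>u\<close> are functions of \<open>\<xi> = x / t\<close>. Each rarefaction wave is parametrized by
  the density \<open>r\<close>: the state \<open>(r, v)\<close> on the wave curve is attained at \<open>\<xi> = v - c(r)\<close>, respectively
  \<open>\<xi> = v + c(r)\<close>. In both waves \<open>\<xi>\<close> is a strictly monotone function of \<open>r\<close> (because \<open>r * c(r)\<close>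
  is strictly increasing), so that the five clauses determine the profiles at every \<open>\<xi>\<close>.
\<close>

definition two_rarefaction_solution ::
  "real \<Rightarrow> real \<Rightarrow> real \<Rightarrow> real \<Rightarrow> real \<Rightarrow> real \<Rightarrow> real \<Rightarrow> real \<Rightarrow>
    (real \<Rightarrow> real) \<Rightarrow> (real \<Rightarrow> real) \<Rightarrow> bool" where
  "two_rarefaction_solution n \<alpha> A B \<rho>m um \<rho>p up \<rho> u \<longleftrightarrow>
    (\<exists>\<rho>s us.
      0 < \<rho>s \<and> \<rho>s \<le> \<rho>m \<and> \<rho>s \<le> \<rho>p \<and>
      up - um = wave_integral n \<alpha> A B \<rho>s \<rho>m + wave_integral n \<alpha> A B \<rho>s \<rho>p \<and>
      us - um = - wave_integral n \<alpha> A B \<rho>m \<rho>s \<and>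
      (\<forall>\<xi>. \<xi> \<le> um - sound_speed n \<alpha> A B \<rho>m \<longrightarrow> \<rho> \<xi> = \<rho>m \<and> u \<xi> = um) \<and>
      (\<forall>r v \<xi>. \<rho>s \<le> r \<and> r \<le> \<rho>m \<and> v - um = - wave_integral n \<alpha> A B \<rho>m r \<and>
                 \<xi> = v - sound_speed n \<alpha> A B r \<longrightarrow> \<rho> \<xi> = r \<and> u \<xi> = v) \<and>
      (\<forall>\<xi>. us - sound_speed n \<alpha> A B \<rho>s \<le> \<xi> \<and> \<xi> \<le> us + sound_speed n \<alpha> A B \<rho>s \<longrightarrow>
                 \<rho> \<xi> = \<rho>s \<and> u \<xi> = us) \<and>
      (\<forall>r v \<xi>. \<rho>s \<le> r \<and> r \<le> \<rho>p \<and> up - v = wave_integral n \<alpha> A B r \<rho>p \<and>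
                 \<xi> = v + sound_speed n \<alpha> A B r \<longrightarrow> \<rho> \<xi> = r \<and> u \<xi> = v) \<and>
      (\<forall>\<xi>. up + sound_speed n \<alpha> A B \<rho>p \<le> \<xi> \<longrightarrow> \<rho> \<xi> = \<rho>p \<and> u \<xi> = up))"

definition vacuum_density :: "real \<Rightarrow> real \<Rightarrow> real \<Rightarrow> real \<Rightarrow> real \<Rightarrow> real" where
  "vacuum_density \<rho>m um \<rho>p up \<xi> = (if \<xi> \<le> um then \<rho>m else if \<xi> < up then 0 else \<rho>p)"

text \<open>
  Inside the vacuum the velocity \<open>\<xi>\<close> is a convention. The velocities of the Riemann solutions do not
  converge to it there in general (for \<open>n > 1\<close> they tend to the constant \<open>(um + up) / 2\<close> on
  an interval of length \<open>(up - um) * (\<alpha> + 1) / 2\<close>); what converges is the pair \<open>(\<rho>, \<rho> * u)\<close>.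
\<close>

definition vacuum_velocity :: "real \<Rightarrow> real \<Rightarrow> real \<Rightarrow> real" where
  "vacuum_velocity um up \<xi> = (if \<xi> \<le> um then um else if \<xi> < up then \<xi> else up)"

text \<open>
  Test functions of class \<open>C\<^sup>1\<close> with compact support in the \<open>(x, t)\<close>-plane, together with their
  partial derivatives. They need not vanish on the line \<open>t = 0\<close>.
\<close>

definition test_function ::
  "(real \<Rightarrow> real \<Rightarrow> real) \<Rightarrow> (real \<Rightarrow> real \<Rightarrow> real) \<Rightarrow> (real \<Rightarrow> real \<Rightarrow> real) \<Rightarrow> bool" where
  "test_function \<phi> \<phi>x \<phi>t \<longleftrightarrow>
    (\<forall>x t. ((\<lambda>(x, t). \<phi> x t) has_derivative (\<lambda>(h, k). \<phi>x x t * h + \<phi>t x t * k)) (at (x, t))) \<and>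
    continuous_on UNIV (\<lambda>(x, t). \<phi>x x t) \<and>
    continuous_on UNIV (\<lambda>(x, t). \<phi>t x t) \<and>
    (\<exists>K. compact K \<and> (\<forall>x t. (x, t) \<notin> K \<longrightarrow> \<phi> x t = 0))"

text \<open>Weak solutions of \<open>w\<^sub>t + f\<^sub>x = 0\<close> for \<open>t > 0\<close> with initial data \<open>w(x, 0) = w0(x)\<close>.\<close>

definition weak_solution ::
  "(real \<Rightarrow> real \<Rightarrow> real) \<Rightarrow> (real \<Rightarrow> real \<Rightarrow> real) \<Rightarrow> (real \<Rightarrow> real) \<Rightarrow> bool" where
  "weak_solution w f w0 \<longleftrightarrow>
    (\<forall>\<phi> \<phi>x \<phi>t. test_function \<phi> \<phi>x \<phi>t \<longrightarrow>
      (LINT p:UNIV \<times> {0<..}|lborel.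
         (case p of (x, t) \<Rightarrow> w x t * \<phi>t x t + f x t * \<phi>x x t))
      + (LBINT x. w0 x * \<phi> x 0) = 0)"

text \<open>
  Bounded self-similar weak solutions of the transport equations with Riemann data. The equations
  do not see the velocity where the density vanishes; the convention is that a vacuum state
  at \<open>\<xi>\<close> is written \<open>(0, \<xi>)\<close>.
\<close>

definition transport_riemann_solution ::
  "real \<Rightarrow> real \<Rightarrow> real \<Rightarrow> real \<Rightarrow> (real \<Rightarrow> real) \<Rightarrow> (real \<Rightarrow> real) \<Rightarrow> bool" where
  "transport_riemann_solution \<rho>m um \<rho>p up \<rho> u \<longleftrightarrow>
    \<rho> \<in> borel_measurable borel \<and> u \<in> borel_measurable borel \<and>
    bounded (range \<rho>) \<and> bounded (range u) \<and>
    (\<forall>\<xi>. \<rho> \<xi> \<ge> 0) \<and> (\<forall>\<xi>. \<rho> \<xi> = 0 \<longrightarrow> u \<xi> = \<xi>) \<and>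
    weak_solution (\<lambda>x t. \<rho> (x / t)) (\<lambda>x t. \<rho> (x / t) * u (x / t))
      (\<lambda>x. if x < 0 then \<rho>m else \<rho>p) \<and>
    weak_solution (\<lambda>x t. \<rho> (x / t) * u (x / t)) (\<lambda>x t. \<rho> (x / t) * (u (x / t))\<^sup>2)
      (\<lambda>x. if x < 0 then \<rho>m * um else \<rho>p * up)"

end

theory Submission
  imports Defs
begin

text \<open>
  Convergence: for small \<open>A, B\<close> the wave integral over a fixed compact interval \<open>[\<delta>, r]\<close>, \<open>r \<in> {\<rho>m, \<rho>p}\<close>, is small,
  so the part of each rarefaction wave with density at least \<open>\<delta>\<close> is squeezed into a neighbourhood
  of \<open>um\<close> or \<open>up\<close>; at a fixed \<open>\<xi>\<close> strictly between them the density is eventually below \<open>\<delta>\<close>.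

  The vacuum profile is a weak solution because each constant half-plane state is transported
  along the lines \<open>x - c t = const\<close>, where the weak form is the fundamental theorem of calculus.

  Uniqueness: put \<open>m = \<rho> (u - \<xi>)\<close> and \<open>q = u m\<close>. Testing with functions \<open>\<Theta>(x/t) \<chi>(t)\<close> gives
  \<open>m' = -\<rho>\<close> and \<open>q' = -\<rho> u\<close> weakly, so \<open>m\<close> and \<open>q\<close> have Lipschitz versions and \<open>m\<close> is decreasing.
  Where \<open>m \<noteq> 0\<close>, the quotient \<open>u = q / m\<close> has derivative \<open>(-\<rho> u m + u m \<rho>) / m\<^sup>2 = 0\<close>, whence \<open>u = c\<close> and
  \<open>m = K (c - \<xi>)\<close>. Boundedness of \<open>u\<close> forces \<open>m > 0\<close> near \<open>-\<infinity>\<close> and \<open>m < 0\<close> near \<open>\<infinity>\<close>, and on the interval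
  in between \<open>m\<close> vanishes, hence so does \<open>\<rho>\<close>. The initial data fix the constants.
\<close>

subsection \<open>Vanishing pressure limit of the two-rarefaction solution\<close>

lemma continuous_on_sound_speed:
  assumes "\<And>s. s \<in> S \<Longrightarrow> 0 < s"
  shows "continuous_on S (sound_speed n \<alpha> A B)"
  unfolding sound_speed_def using assms
  by (intro continuous_intros) force+

lemma continuous_on_sound_speed_div:
  assumes "0 < a"
  shows "continuous_on {a..b} (\<lambda>s. sound_speed n \<alpha> A B s / s)"
  using assms by (intro continuous_intros continuous_on_sound_speed) auto

lemma sound_speed_nonneg:
  assumes "0 \<le> n" "0 \<le> \<alpha>" "0 \<le> A" "0 \<le> B"
  shows "0 \<le> sound_speed n \<alpha> A B \<rho>"
  unfolding sound_speed_def using assms by simp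

lemma wave_integral_eq_integral:
  assumes "0 < a" "a \<le> b"
  shows "wave_integral n \<alpha> A B a b = integral {a..b} (\<lambda>s. sound_speed n \<alpha> A B s / s)"
  unfolding wave_integral_def
  using assms borel_integrable_atLeastAtMost'[OF continuous_on_sound_speed_div[OF assms(1)]]
  by (intro interval_integral_eq_integral)

lemma wave_integral_swap: "wave_integral n \<alpha> A B a b = - wave_integral n \<alpha> A B b a"
  unfolding wave_integral_def by (rule interval_integral_endpoints_reverse)

lemma wave_integral_mono:
  assumes "0 \<le> n" "0 \<le> \<alpha>" "0 \<le> A" "0 \<le> B" "0 < a" "a \<le> a'" "a' \<le> b"
  shows "wave_integral n \<alpha> A B a' b \<le> wave_integral n \<alpha> A B a b"
proof -
  have "integral {a'..b} (\<lambda>s. sound_speed n \<alpha> A B s / s)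
      \<le> integral {a..b} (\<lambda>s. sound_speed n \<alpha> A B s / s)"
    using assms
    by (intro integral_subset_le integrable_continuous_interval continuous_on_sound_speed_div)
      (auto intro!: divide_nonneg_nonneg sound_speed_nonneg)
  then show ?thesis
    using assms by (simp add: wave_integral_eq_integral)
qed

lemma wave_integral_nonneg:
  assumes "0 \<le> n" "0 \<le> \<alpha>" "0 \<le> A" "0 \<le> B" "0 < a" "a \<le> b"
  shows "0 \<le> wave_integral n \<alpha> A B a b"
  unfolding wave_integral_eq_integral[OF assms(5,6)] using assms
  by (intro integral_nonneg integrable_continuous_interval continuous_on_sound_speed_div
        divide_nonneg_nonneg sound_speed_nonneg) auto

text \<open>For \<open>1 \<le> n\<close> the first power under the root increases with the density
  and the second decreases, so on \<open>[a, b]\<close> they peak at opposite ends, while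
  \<open>1 / s\<close> peaks at \<open>a\<close>. The resulting bound is explicit in
  \<open>A\<close> and \<open>B\<close>.\<close>

lemma wave_integral_le:
  assumes "1 \<le> n" "0 \<le> \<alpha>" "0 \<le> A" "0 \<le> B" "0 < a" "a \<le> b"
  shows "wave_integral n \<alpha> A B a b
    \<le> (b - a) * (sqrt (A * n * b powr (n - 1) + \<alpha> * B * a powr (- \<alpha> - 1)) / a)"
    (is "_ \<le> _ * ?C")
proof -
  have "sound_speed n \<alpha> A B s / s \<le> ?C" if "s \<in> {a..b}" for s
    unfolding sound_speed_def using that assms
    by (intro frac_le real_sqrt_le_mono add_mono mult_left_mono powr_mono2 powr_mono2') auto
  then have "integral {a..b} (\<lambda>s. sound_speed n \<alpha> A B s / s) \<le> integral {a..b} (\<lambda>s. ?C)"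
    using assms
    by (intro integral_le integrable_continuous_interval continuous_on_sound_speed_div) auto
  then show ?thesis
    using assms by (simp add: wave_integral_eq_integral)
qed

section \<open>The limit of vanishing \<open>A\<close> and \<open>B\<close>\<close>

abbreviation (input) small_parameters :: "(real \<times> real) filter" where
  "small_parameters \<equiv> at (0, 0) within {0<..} \<times> {0<..}"

lemma eventually_small_parameters_pos:
  "\<forall>\<^sub>F (A, B) in small_parameters. 0 < A \<and> 0 < B"
  unfolding eventually_at_filter by (rule always_eventually) auto

text \<open>The sound speed at a fixed density and the bound on the wave integral over a fixed
  interval both have this form, with \<open>p\<close>, \<open>q\<close>, \<open>r\<close>
  independent of \<open>A\<close> and \<open>B\<close>.\<close>

lemma sqrt_small_parameters_tendsto_0:
  "((\<lambda>(A, B). sqrt (A * p + q * B * r)) \<longlongrightarrow> 0) small_parameters"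
  unfolding case_prod_unfold by (auto intro!: tendsto_eq_intros)

lemma sound_speed_tendsto_0:
  "((\<lambda>(A, B). sound_speed n \<alpha> A B \<rho>) \<longlongrightarrow> 0) small_parameters"
  unfolding sound_speed_def mult.assoc[of _ n]
  by (rule sqrt_small_parameters_tendsto_0)

lemma wave_integral_tendsto_0:
  assumes "1 \<le> n" "0 \<le> \<alpha>" "0 < a" "a \<le> b"
  shows "((\<lambda>(A, B). wave_integral n \<alpha> A B a b) \<longlongrightarrow> 0) small_parameters"
proof (rule tendsto_sandwich[where f = "\<lambda>_. 0"])
  show "\<forall>\<^sub>F x in small_parameters. 0 \<le> (case x of (A, B) \<Rightarrow> wave_integral n \<alpha> A B a b)"
    using eventually_small_parameters_pos
    by eventually_elim (use assms in \<open>auto intro!: wave_integral_nonneg\<close>)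
  let ?g = "\<lambda>(A, B). sqrt (A * (n * b powr (n - 1)) + \<alpha> * B * a powr (- \<alpha> - 1))"
  show "\<forall>\<^sub>F x in small_parameters. (case x of (A, B) \<Rightarrow> wave_integral n \<alpha> A B a b)
      \<le> (b - a) * (?g x / a)"
    using eventually_small_parameters_pos
  proof eventually_elim
    case (elim x)
    then show ?case
      using assms wave_integral_le[of n \<alpha> "fst x" "snd x" a b]
      by (auto simp: case_prod_unfold mult.assoc)
  qed
  show "((\<lambda>x. (b - a) * (?g x / a)) \<longlongrightarrow> 0) small_parameters"
    using assms
    by (auto intro!: tendsto_eq_intros sqrt_small_parameters_tendsto_0)
qed auto

text \<open>A point of the 1-wave with density \<open>r \<ge> \<delta>\<close> sits at
  \<open>\<xi> = um + I r \<rho>m - c r\<close>, which is at most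
  \<open>um + I \<delta> \<rho>m\<close>; the 2-wave is symmetric. So \<open>lo\<close> and
  \<open>hi\<close> exclude such points. The velocity bounds hold because the wave integrals are
  nonnegative and those from \<open>\<rho>s\<close> add up to \<open>up - um\<close>.\<close>

lemma two_rarefaction_solution_bounds:
  assumes sol: "two_rarefaction_solution n \<alpha> A B \<rho>m um \<rho>p up \<rho> u"
    and pos: "0 \<le> n" "0 \<le> \<alpha>" "0 \<le> A" "0 \<le> B"
    and \<delta>: "0 < \<delta>" "\<delta> \<le> \<rho>m" "\<delta> \<le> \<rho>p"
    and lo: "um + wave_integral n \<alpha> A B \<delta> \<rho>m < \<xi>"
    and hi: "\<xi> < up - wave_integral n \<alpha> A B \<delta> \<rho>p"
  shows "0 < \<rho> \<xi>" "\<rho> \<xi> < \<delta>" "um \<le> u \<xi>" "u \<xi> \<le> up"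
proof -
  define I where "I = wave_integral n \<alpha> A B"
  define c where "c = sound_speed n \<alpha> A B"
  have I_swap: "I a b = - I b a" for a b
    unfolding I_def by (rule wave_integral_swap)
  have I_mono: "I a' b \<le> I a b" if "0 < a" "a \<le> a'" "a' \<le> b" for a a' b
    unfolding I_def using pos that by (intro wave_integral_mono)
  have I_nonneg: "0 \<le> I a b" if "0 < a" "a \<le> b" for a b
    unfolding I_def using pos that by (intro wave_integral_nonneg)
  have c_nonneg: "0 \<le> c s" for s
    unfolding c_def using pos by (intro sound_speed_nonneg)
  from sol obtain \<rho>s us where \<rho>s: "0 < \<rho>s" "\<rho>s \<le> \<rho>m" "\<rho>s \<le> \<rho>p"
    and eq: "up - um = I \<rho>s \<rho>m + I \<rho>s \<rho>p" and us: "us - um = - I \<rho>m \<rho>s"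
    and wave1: "\<And>r v \<xi>. \<rho>s \<le> r \<Longrightarrow> r \<le> \<rho>m \<Longrightarrow> v - um = - I \<rho>m r \<Longrightarrow> \<xi> = v - c r
        \<Longrightarrow> \<rho> \<xi> = r \<and> u \<xi> = v"
    and mid: "\<And>\<xi>. us - c \<rho>s \<le> \<xi> \<Longrightarrow> \<xi> \<le> us + c \<rho>s \<Longrightarrow> \<rho> \<xi> = \<rho>s \<and> u \<xi> = us"
    and wave2: "\<And>r v \<xi>. \<rho>s \<le> r \<Longrightarrow> r \<le> \<rho>p \<Longrightarrow> up - v = I r \<rho>p \<Longrightarrow> \<xi> = v + c r
        \<Longrightarrow> \<rho> \<xi> = r \<and> u \<xi> = v"
    unfolding two_rarefaction_solution_def I_def[symmetric] c_def[symmetric] by (elim exE conjE) (rule that, auto)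
  have us': "us = um + I \<rho>s \<rho>m" "us = up - I \<rho>s \<rho>p"
    using us eq I_swap[of \<rho>m \<rho>s] by auto
  have lo': "um + I \<delta> \<rho>m < \<xi>" and hi': "\<xi> < up - I \<delta> \<rho>p"
    using lo hi unfolding I_def .
  \<comment> \<open>Otherwise \<open>up - um\<close> would be at most the sum of the wave integrals
    from \<open>\<delta>\<close>, whereas \<open>lo\<close> and \<open>hi\<close> together make it
    larger.\<close>
  have "\<rho>s < \<delta>"
  proof (rule ccontr)
    assume "\<not> \<rho>s < \<delta>"
    then have "I \<rho>s \<rho>m \<le> I \<delta> \<rho>m" "I \<rho>s \<rho>p \<le> I \<delta> \<rho>p"
      using \<delta> \<rho>s by (auto intro!: I_mono)
    then show False
      using eq lo' hi' by linarith
  qed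
  \<comment> \<open>Continuity in the lower bound lets the intermediate value theorem find the
    density attained at \<open>\<xi>\<close>.\<close>
  have cont: "continuous_on {\<rho>s..b} (\<lambda>r. I r b)" for b
  proof -
    have "continuous_on {\<rho>s..b} (\<lambda>r. integral {r..b} (\<lambda>s. c s / s))"
      unfolding c_def using \<rho>s
      by (intro indefinite_integral_continuous_1' integrable_continuous_interval
          continuous_on_sound_speed_div)
    then show ?thesis
      by (rule continuous_on_eq) (use \<rho>s in \<open>auto simp: I_def c_def wave_integral_eq_integral\<close>)
  qed
  have cont_c: "continuous_on {\<rho>s..b} c" for b
    unfolding c_def using \<rho>s by (intro continuous_on_sound_speed) auto
  consider "\<xi> \<le> us - c \<rho>s" | "us - c \<rho>s \<le> \<xi>" "\<xi> \<le> us + c \<rho>s" | "us + c \<rho>s \<le> \<xi>"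
    by linarith
  then have "0 < \<rho> \<xi> \<and> \<rho> \<xi> < \<delta> \<and> um \<le> u \<xi> \<and> u \<xi> \<le> up"
  proof cases
    case 1
    \<comment> \<open>The position of density \<open>r\<close> in the 1-wave. It is at most
      \<open>\<xi>\<close> for \<open>\<rho>m\<close> and at least \<open>\<xi>\<close> for
      \<open>\<rho>s\<close>, so some density of the wave is attained exactly at
      \<open>\<xi>\<close>.\<close>
    let ?x = "\<lambda>r. um + I r \<rho>m - c r"
    have "I \<rho>m \<rho>m = 0"
      using I_swap[of \<rho>m \<rho>m] by simp
    moreover have "0 \<le> I \<delta> \<rho>m"
      using \<delta> by (intro I_nonneg)
    ultimately have "?x \<rho>m \<le> \<xi>"
      using lo' c_nonneg[of \<rho>m] by linarith
    then obtain r where r: "\<rho>s \<le> r" "r \<le> \<rho>m" "?x r = \<xi>"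
      using IVT2'[of ?x \<rho>m \<xi> \<rho>s] 1 \<rho>s us'
        continuous_on_diff[OF continuous_on_add[OF continuous_on_const cont] cont_c] by auto
    have val: "\<rho> \<xi> = r \<and> u \<xi> = um + I r \<rho>m"
      using r I_swap[of r \<rho>m] by (intro wave1) auto
    have "r < \<delta>"
    proof (rule ccontr)
      assume "\<not> r < \<delta>"
      then have "I r \<rho>m \<le> I \<delta> \<rho>m"
        using r \<delta> by (intro I_mono) auto
      then show False
        using r lo' c_nonneg[of r] by linarith
    qed
    moreover have "0 \<le> I r \<rho>m" "I r \<rho>m \<le> I \<rho>s \<rho>m" "0 \<le> I \<rho>s \<rho>p"
      using r \<rho>s by (auto intro!: I_nonneg I_mono)
    ultimately show ?thesis
      using val r \<rho>s us' by auto
  next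
    case 2
    have "0 \<le> I \<rho>s \<rho>m" "0 \<le> I \<rho>s \<rho>p"
      using \<rho>s by (auto intro!: I_nonneg)
    then show ?thesis
      using mid[OF 2] \<open>\<rho>s < \<delta>\<close> \<rho>s us' by auto
  next
    case 3
    let ?x = "\<lambda>r. up - I r \<rho>p + c r"
    have "I \<rho>p \<rho>p = 0"
      using I_swap[of \<rho>p \<rho>p] by simp
    moreover have "0 \<le> I \<delta> \<rho>p"
      using \<delta> by (intro I_nonneg)
    ultimately have "\<xi> \<le> ?x \<rho>p"
      using hi' c_nonneg[of \<rho>p] by linarith
    then obtain r where r: "\<rho>s \<le> r" "r \<le> \<rho>p" "?x r = \<xi>"
      using IVT'[of ?x \<rho>s \<xi> \<rho>p] 3 \<rho>s us'
        continuous_on_add[OF continuous_on_diff[OF continuous_on_const cont] cont_c] by auto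
    have val: "\<rho> \<xi> = r \<and> u \<xi> = up - I r \<rho>p"
      using r by (intro wave2) auto
    have "r < \<delta>"
    proof (rule ccontr)
      assume "\<not> r < \<delta>"
      then have "I r \<rho>p \<le> I \<delta> \<rho>p"
        using r \<delta> by (intro I_mono) auto
      then show False
        using r hi' c_nonneg[of r] by linarith
    qed
    moreover have "0 \<le> I r \<rho>p" "I r \<rho>p \<le> I \<rho>s \<rho>p" "0 \<le> I \<rho>s \<rho>m"
      using r \<rho>s by (auto intro!: I_nonneg I_mono)
    ultimately show ?thesis
      using val r \<rho>s us' by auto
  qed
  then show "0 < \<rho> \<xi>" "\<rho> \<xi> < \<delta>" "um \<le> u \<xi>" "u \<xi> \<le> up"
    by auto
qed

lemma two_rarefaction_solution_left:
  assumes "two_rarefaction_solution n \<alpha> A B \<rho>m um \<rho>p up \<rho> u" "\<xi> \<le> um - sound_speed n \<alpha> A B \<rho>m"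
  shows "\<rho> \<xi> = \<rho>m" "u \<xi> = um"
  using assms unfolding two_rarefaction_solution_def by (elim exE conjE, simp)+

lemma two_rarefaction_solution_right:
  assumes "two_rarefaction_solution n \<alpha> A B \<rho>m um \<rho>p up \<rho> u" "up + sound_speed n \<alpha> A B \<rho>p \<le> \<xi>"
  shows "\<rho> \<xi> = \<rho>p" "u \<xi> = up"
  using assms unfolding two_rarefaction_solution_def by (elim exE conjE, simp)+

section \<open>Pointwise limits away from \<open>um\<close> and \<open>up\<close>\<close>

text \<open>The wave integral between \<open>\<rho>m\<close> and \<open>\<rho>p\<close> tends to 0
  whichever density is larger, so its modulus drops below the fixed gap
  \<open>up - um\<close>.\<close>

lemma eventually_R1R2:
  assumes "1 \<le> n" "0 \<le> \<alpha>" "0 < \<rho>m" "0 < \<rho>p" "um < up"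
  shows "\<forall>\<^sub>F (A, B) in small_parameters. (\<rho>p, up) \<in> R1R2 n \<alpha> A B \<rho>m um"
proof -
  have "((\<lambda>(A, B). wave_integral n \<alpha> A B \<rho>m \<rho>p) \<longlongrightarrow> 0) small_parameters"
  proof (cases "\<rho>m \<le> \<rho>p")
    case True
    then show ?thesis using assms by (intro wave_integral_tendsto_0)
  next
    case False
    then have "((\<lambda>x. - (case x of (A, B) \<Rightarrow> wave_integral n \<alpha> A B \<rho>p \<rho>m)) \<longlongrightarrow> - 0) small_parameters"
      using assms by (intro tendsto_minus wave_integral_tendsto_0) auto
    then show ?thesis
      by (subst wave_integral_swap) (simp add: case_prod_unfold)
  qed
  then have "\<forall>\<^sub>F x in small_parameters. \<bar>case x of (A, B) \<Rightarrow> wave_integral n \<alpha> A B \<rho>m \<rho>p\<bar> < up - um"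
    using assms by (intro order_tendstoD(2)[OF tendsto_rabs_zero]) auto
  then show ?thesis
    by eventually_elim (use assms in \<open>auto simp: R1R2_def\<close>)
qed

text \<open>Outside \<open>[um, up]\<close> a constant state covers \<open>\<xi>\<close> once the
  sound speed there is less than the distance to \<open>um\<close> or \<open>up\<close>. In between,
  the density tends to 0 while the velocity merely stays bounded, which suffices for the
  product.\<close>

lemma two_rarefaction_limit:
  fixes \<rho> u :: "real \<Rightarrow> real \<Rightarrow> real \<Rightarrow> real"
  assumes n: "1 \<le> n" and \<alpha>: "0 \<le> \<alpha>" and \<rho>mp: "0 < \<rho>m" "0 < \<rho>p"
    and sol: "\<forall>\<^sub>F (A, B) in small_parameters.
      two_rarefaction_solution n \<alpha> A B \<rho>m um \<rho>p up (\<rho> A B) (u A B)"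
    and "um < up" and \<xi>: "\<xi> \<noteq> um" "\<xi> \<noteq> up"
  shows "((\<lambda>(A, B). \<rho> A B \<xi>) \<longlongrightarrow> vacuum_density \<rho>m um \<rho>p up \<xi>) small_parameters" (is ?density)
    and "((\<lambda>(A, B). \<rho> A B \<xi> * u A B \<xi>) \<longlongrightarrow>
        vacuum_density \<rho>m um \<rho>p up \<xi> * vacuum_velocity um up \<xi>) small_parameters" (is ?momentum)
    and "vacuum_density \<rho>m um \<rho>p up \<xi> \<noteq> 0 \<Longrightarrow>
        ((\<lambda>(A, B). u A B \<xi>) \<longlongrightarrow> vacuum_velocity um up \<xi>) small_parameters"
proof -
  have speed: "\<forall>\<^sub>F x in small_parameters. (case x of (A, B) \<Rightarrow> sound_speed n \<alpha> A B r) < d"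
    if "0 < d" for r d
    using that by (intro order_tendstoD(2)[OF sound_speed_tendsto_0])
  have wave: "\<forall>\<^sub>F x in small_parameters. (case x of (A, B) \<Rightarrow> wave_integral n \<alpha> A B \<delta> r) < d"
    if "0 < d" "0 < \<delta>" "\<delta> \<le> r" for \<delta> r d
    using that n \<alpha> by (intro order_tendstoD(2)[OF wave_integral_tendsto_0]) auto
  consider "\<xi> < um" | "um < \<xi>" "\<xi> < up" | "up < \<xi>"
    using \<xi> by linarith
  then have "?density \<and> ?momentum \<and> (vacuum_density \<rho>m um \<rho>p up \<xi> \<noteq> 0 \<longrightarrow>
        ((\<lambda>(A, B). u A B \<xi>) \<longlongrightarrow> vacuum_velocity um up \<xi>) small_parameters)"
  proof cases
    case 1
    have "\<forall>\<^sub>F x in small_parameters. (case x of (A, B) \<Rightarrow> \<rho> A B \<xi>) = \<rho>m \<and>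
        (case x of (A, B) \<Rightarrow> u A B \<xi>) = um"
      using sol speed[of "um - \<xi>" \<rho>m, OF diff_gt_0_iff_gt[THEN iffD2, OF 1]]
    proof eventually_elim
      case (elim x)
      then show ?case
        using two_rarefaction_solution_left[of n \<alpha> "fst x" "snd x"] by (auto simp: case_prod_unfold)
    qed
    then have "((\<lambda>x. case x of (A, B) \<Rightarrow> \<rho> A B \<xi>) \<longlongrightarrow> \<rho>m) small_parameters"
      "((\<lambda>x. case x of (A, B) \<Rightarrow> u A B \<xi>) \<longlongrightarrow> um) small_parameters"
      by (auto intro!: tendsto_eventually elim: eventually_mono)
    with tendsto_mult[OF this] show ?thesis
      using 1 by (auto simp: vacuum_density_def vacuum_velocity_def case_prod_unfold)
  next
    case 2
    have small: "\<forall>\<^sub>F x in small_parameters. \<bar>case x of (A, B) \<Rightarrow> \<rho> A B \<xi>\<bar> < \<epsilon> \<and>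
        \<bar>case x of (A, B) \<Rightarrow> u A B \<xi>\<bar> \<le> max \<bar>um\<bar> \<bar>up\<bar>" if "0 < \<epsilon>" for \<epsilon>
    proof -
      \<comment> \<open>The cap by \<open>\<rho>m\<close> and \<open>\<rho>p\<close> makes both wave
        integrals from \<open>\<delta>\<close> run upwards, as the bounds on the profile
        require.\<close>
      define \<delta> where "\<delta> = min \<epsilon> (min \<rho>m \<rho>p)"
      have \<delta>: "0 < \<delta>" "\<delta> \<le> \<rho>m" "\<delta> \<le> \<rho>p" "\<delta> \<le> \<epsilon>"
        using that \<rho>mp by (auto simp: \<delta>_def)
      have *: "\<forall>\<^sub>F x in small_parameters. (case x of (A, B) \<Rightarrow> wave_integral n \<alpha> A B \<delta> \<rho>m) < \<xi> - um"
        "\<forall>\<^sub>F x in small_parameters. (case x of (A, B) \<Rightarrow> wave_integral n \<alpha> A B \<delta> \<rho>p) < up - \<xi>"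
        using \<delta> 2 by (auto intro!: wave)
      show ?thesis
        using sol eventually_small_parameters_pos *
      proof eventually_elim
        case (elim x)
        obtain A B where x: "x = (A, B)"
          by force
        from elim have "0 < \<rho> A B \<xi>" "\<rho> A B \<xi> < \<delta>" "um \<le> u A B \<xi>" "u A B \<xi> \<le> up"
          using two_rarefaction_solution_bounds[of n \<alpha> A B \<rho>m um \<rho>p up "\<rho> A B" "u A B" \<delta> \<xi>]
            n \<alpha> \<delta> by (auto simp: x)
        then show ?case
          using \<delta> by (auto simp: x)
      qed
    qed
    have \<rho>0: "((\<lambda>x. case x of (A, B) \<Rightarrow> \<rho> A B \<xi>) \<longlongrightarrow> 0) small_parameters"
      by (rule tendstoI) (rule eventually_mono[OF small], auto)
    have "((\<lambda>x. (case x of (A, B) \<Rightarrow> \<rho> A B \<xi>) * (case x of (A, B) \<Rightarrow> u A B \<xi>)) \<longlongrightarrow> 0)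
        small_parameters"
      by (rule lim_null_mult_right_bounded[OF \<rho>0, where B = "max \<bar>um\<bar> \<bar>up\<bar>"])
        (rule eventually_mono[OF small[of 1]], auto)
    then show ?thesis
      using 2 \<rho>0 by (auto simp: vacuum_density_def vacuum_velocity_def case_prod_unfold)
  next
    case 3
    have "\<forall>\<^sub>F x in small_parameters. (case x of (A, B) \<Rightarrow> \<rho> A B \<xi>) = \<rho>p \<and>
        (case x of (A, B) \<Rightarrow> u A B \<xi>) = up"
      using sol speed[of "\<xi> - up" \<rho>p, OF diff_gt_0_iff_gt[THEN iffD2, OF 3]]
    proof eventually_elim
      case (elim x)
      then show ?case
        using two_rarefaction_solution_right[of n \<alpha> "fst x" "snd x"] by (auto simp: case_prod_unfold)
    qed
    then have "((\<lambda>x. case x of (A, B) \<Rightarrow> \<rho> A B \<xi>) \<longlongrightarrow> \<rho>p) small_parameters"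
      "((\<lambda>x. case x of (A, B) \<Rightarrow> u A B \<xi>) \<longlongrightarrow> up) small_parameters"
      by (auto intro!: tendsto_eventually elim: eventually_mono)
    with tendsto_mult[OF this] show ?thesis
      using 3 \<open>um < up\<close> by (auto simp: vacuum_density_def vacuum_velocity_def case_prod_unfold)
  qed
  then show ?density ?momentum "vacuum_density \<rho>m um \<rho>p up \<xi> \<noteq> 0 \<Longrightarrow>
        ((\<lambda>(A, B). u A B \<xi>) \<longlongrightarrow> vacuum_velocity um up \<xi>) small_parameters"
    by auto
qed

subsection \<open>Weak form of two transported contact discontinuities\<close>

text \<open>On the open complement of \<open>K\<close> the function is locally 0, so by uniqueness
  of the derivative both partial derivatives vanish there as well, and one \<open>R\<close> serves
  all three functions.\<close>

lemma test_function_support: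
  assumes "test_function \<phi> \<phi>x \<phi>t"
  obtains R where "0 < R"
    "\<And>x t. R < \<bar>x\<bar> \<or> R < \<bar>t\<bar> \<Longrightarrow> \<phi> x t = 0 \<and> \<phi>x x t = 0 \<and> \<phi>t x t = 0"
proof -
  from assms obtain K where K: "compact K" "\<And>x t. (x, t) \<notin> K \<Longrightarrow> \<phi> x t = 0"
    and deriv: "\<And>x t. ((\<lambda>(x, t). \<phi> x t) has_derivative (\<lambda>(h, k). \<phi>x x t * h + \<phi>t x t * k)) (at (x, t))"
    unfolding test_function_def by blast
  obtain R where R: "0 < R" "\<And>p. p \<in> K \<Longrightarrow> norm p \<le> R"
    using compact_imp_bounded[OF K(1)] unfolding bounded_pos by blast
  have "\<phi> x t = 0 \<and> \<phi>x x t = 0 \<and> \<phi>t x t = 0" if "R < \<bar>x\<bar> \<or> R < \<bar>t\<bar>" for x t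
  proof -
    have "\<bar>x\<bar> \<le> norm (x, t)" "\<bar>t\<bar> \<le> norm (x, t)"
      using norm_fst_le[of x t] norm_snd_le[of t x] by auto
    then have notin: "(x, t) \<in> - K"
      using that R(2) by fastforce
    have "((\<lambda>(x, t). \<phi> x t) has_derivative (\<lambda>_. 0)) (at (x, t))"
      by (rule has_derivative_transform_within_open[OF has_derivative_const, where s = "- K"])
        (use K notin compact_imp_closed in auto)
    from has_derivative_unique[OF this deriv]
    have eq: "(\<lambda>_. 0) = (\<lambda>(h, k). \<phi>x x t * h + \<phi>t x t * k)" .
    from fun_cong[OF eq, of "(1, 0)"] fun_cong[OF eq, of "(0, 1)"] show ?thesis
      using notin K by simp
  qed
  with R(1) show ?thesis by (rule that)
qed

text \<open>Supplies the integrability needed for Fubini in the plane.\<close>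

lemma integrable_bounded_mult_compact_support:
  fixes g h :: "real \<times> real \<Rightarrow> real"
  assumes [measurable]: "g \<in> borel_measurable borel" and g: "\<And>p. \<bar>g p\<bar> \<le> C"
    and h: "continuous_on UNIV h" and supp: "\<And>x t. R < \<bar>x\<bar> \<or> R < \<bar>t\<bar> \<Longrightarrow> h (x, t) = 0"
  shows "integrable lborel (\<lambda>p. g p * h p)"
proof -
  have [measurable]: "h \<in> borel_measurable borel"
    using h by (rule borel_measurable_continuous_onI)
  have "compact (cbox (-R, -R) (R, R))"
    by (rule compact_cbox)
  then have "bounded (h ` cbox (-R, -R) (R, R))"
    using h by (intro compact_imp_bounded compact_continuous_image) (auto intro: continuous_on_subset)
  then obtain D where D: "\<And>p. p \<in> cbox (-R, -R) (R, R) \<Longrightarrow> \<bar>h p\<bar> \<le> D"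
    unfolding bounded_iff by auto
  show ?thesis
  proof (rule integrableI_bounded_set[where A = "cbox (-R, -R) (R, R)" and B = "C * D"])
    show "AE p in lborel. p \<in> cbox (-R, -R) (R, R) \<longrightarrow> norm (g p * h p) \<le> C * D"
      using g D by (intro always_eventually allI impI)
        (auto simp: abs_mult intro!: mult_mono intro: order_trans[OF abs_ge_zero])
    show "AE p in lborel. p \<notin> cbox (-R, -R) (R, R) \<longrightarrow> g p * h p = 0"
    proof (intro always_eventually allI impI)
      fix p :: "real \<times> real"
      assume "p \<notin> cbox (-R, -R) (R, R)"
      then have "R < \<bar>fst p\<bar> \<or> R < \<bar>snd p\<bar>"
        by (cases p) (auto simp: cbox_Pair_eq)
      then show "g p * h p = 0"
        using supp[of "fst p" "snd p"] by simp
    qed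
  qed (auto intro: emeasure_bounded_finite[unfolded infinity_ennreal_def, OF bounded_cbox])
qed

lemma continuous_on_slice:
  fixes h :: "real \<times> real \<Rightarrow> real"
  assumes "continuous_on UNIV h" "continuous_on UNIV f"
  shows "continuous_on UNIV (\<lambda>t. h (f t, t))"
  using assms(2) by (intro continuous_on_compose2[OF assms(1)]) (auto intro!: continuous_intros)

text \<open>By the chain rule the integrand is the derivative of \<open>\<phi>\<close> along the
  line through \<open>(y, 0)\<close> with speed \<open>c\<close>, so only the boundary value at
  \<open>t = 0\<close> survives.\<close>

lemma test_function_line_integral:
  assumes "test_function \<phi> \<phi>x \<phi>t"
  shows "(LINT t|lborel. indicator {0<..} t * (\<phi>t (y + c * t) t + c * \<phi>x (y + c * t) t)) = - \<phi> y 0"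
proof -
  obtain R where R: "0 < R"
    "\<And>x t. R < \<bar>x\<bar> \<or> R < \<bar>t\<bar> \<Longrightarrow> \<phi> x t = 0 \<and> \<phi>x x t = 0 \<and> \<phi>t x t = 0"
    by (rule test_function_support[OF assms]) blast
  \<comment> \<open>Strictly beyond the support, so that \<open>\<phi>\<close> vanishes at the upper
    end.\<close>
  let ?S = "R + 1"
  have deriv: "((\<lambda>(x, t). \<phi> x t) has_derivative (\<lambda>(h, k). \<phi>x x t * h + \<phi>t x t * k)) (at (x, t))"
    and contx: "continuous_on UNIV (\<lambda>(x, t). \<phi>x x t)"
    and contt: "continuous_on UNIV (\<lambda>(x, t). \<phi>t x t)" for x t
    using assms unfolding test_function_def by blast+
  define H' where "H' t = \<phi>t (y + c * t) t + c * \<phi>x (y + c * t) t" for t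
  have d: "DERIV (\<lambda>t. \<phi> (y + c * t) t) t :> H' t" for t
  proof -
    have "((\<lambda>t. (y + c * t, t)) has_derivative (\<lambda>h. (c * h, h))) (at t)"
      by (auto intro!: derivative_eq_intros)
    from has_derivative_compose[OF this deriv]
    have "((\<lambda>t. \<phi> (y + c * t) t) has_derivative
        (\<lambda>k. \<phi>x (y + c * t) t * (c * k) + \<phi>t (y + c * t) t * k)) (at t)"
      by (simp add: case_prod_unfold)
    moreover have "(\<lambda>k. \<phi>x (y + c * t) t * (c * k) + \<phi>t (y + c * t) t * k) = (*) (H' t)"
      by (auto simp: H'_def algebra_simps)
    ultimately show ?thesis
      by (simp add: has_field_derivative_def)
  qed
  have contH: "continuous_on UNIV H'"
    unfolding H'_def
    using continuous_on_slice[OF contx, of "\<lambda>t. y + c * t"] continuous_on_slice[OF contt, of "\<lambda>t. y + c * t"]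
    by (simp add: continuous_intros)
  \<comment> \<open>The integrands can differ only at \<open>t = 0\<close>; beyond \<open>?S\<close>
    both are 0.\<close>
  have "(LINT t|lborel. indicator {0<..} t * H' t) = (LINT t|lborel. H' t * indicator {0..?S} t)"
  proof (rule integral_cong_AE)
    note [measurable] = borel_measurable_continuous_onI[OF contH]
    show "(\<lambda>t. indicator {0<..} t * H' t) \<in> borel_measurable lborel"
      "(\<lambda>t. H' t * indicator {0..?S} t) \<in> borel_measurable lborel"
      by measurable
    show "AE t in lborel. indicator {0<..} t * H' t = H' t * indicator {0..?S} t"
      using AE_lborel_singleton[of 0]
    proof eventually_elim
      case (elim t)
      then show ?case
        using R(2)[of t "y + c * t"] R(2)[of "y + c * t" t]
        by (cases "t \<le> ?S") (auto simp: H'_def indicator_def)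
    qed
  qed
  also have "\<dots> = \<phi> (y + c * ?S) ?S - \<phi> (y + c * 0) 0"
    using R(1) d contH by (intro integral_FTC_Icc_real)
      (auto simp: continuous_on_eq_continuous_at)
  also have "\<dots> = - \<phi> y 0"
    using R by simp
  finally show ?thesis
    unfolding H'_def .
qed

text \<open>The shear \<open>x = y + c * t\<close> turns a profile carried with speed
  \<open>c\<close> into a function of \<open>y\<close> alone. Fubini then reduces the claim to one
  line integral for each \<open>y\<close>.\<close>

lemma transport_weak_form:
  fixes w :: "real \<Rightarrow> real"
  assumes \<phi>: "test_function \<phi> \<phi>x \<phi>t"
    and [measurable]: "w \<in> borel_measurable borel" and w: "\<And>y. \<bar>w y\<bar> \<le> C"
  shows "(LINT p|lborel. indicator {0<..} (snd p) * w (fst p - c * snd p) *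
        (\<phi>t (fst p) (snd p) + c * \<phi>x (fst p) (snd p))) = - (LINT y|lborel. w y * \<phi> y 0)" (is "?L = _")
    and "integrable lborel (\<lambda>p. indicator {0<..} (snd p) * w (fst p - c * snd p) *
        (\<phi>t (fst p) (snd p) + c * \<phi>x (fst p) (snd p)))"
proof -
  obtain R where R: "0 < R"
    "\<And>x t. R < \<bar>x\<bar> \<or> R < \<bar>t\<bar> \<Longrightarrow> \<phi> x t = 0 \<and> \<phi>x x t = 0 \<and> \<phi>t x t = 0"
    by (rule test_function_support[OF \<phi>]) blast
  have C: "0 \<le> C"
    using w[of 0] by linarith
  define h where "h p = \<phi>t (fst p) (snd p) + c * \<phi>x (fst p) (snd p)" for p
  have conth: "continuous_on UNIV h"
    using \<phi> unfolding test_function_def h_def case_prod_unfold by (auto intro!: continuous_intros)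
  have hsupp: "h (x, t) = 0" if "R < \<bar>x\<bar> \<or> R < \<bar>t\<bar>" for x t
    using R(2)[OF that] by (simp add: h_def)
  have meas1: "(\<lambda>p. indicator {0<..} (snd p) * w (fst p - c * snd p)) \<in> borel_measurable borel"
    unfolding borel_prod[symmetric] by measurable
  have meas2: "(\<lambda>p :: real \<times> real. indicator {0<..} (snd p) * w (fst p)) \<in> borel_measurable borel"
    unfolding borel_prod[symmetric] by measurable
  have 1: "integrable lborel (\<lambda>p. (indicator {0<..} (snd p) * w (fst p - c * snd p)) * h p)"
    by (rule integrable_bounded_mult_compact_support[where C = C and R = R, OF meas1])
      (use conth hsupp w C in \<open>auto split: split_indicator\<close>)
  \<comment> \<open>Shearing widens the support: for \<open>\<bar>t\<bar> \<le> R\<close> it moves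
    \<open>x\<close> by at most \<open>\<bar>c\<bar> * R\<close>.\<close>
  have 2: "integrable lborel (\<lambda>p. (indicator {0<..} (snd p) * w (fst p)) * h (fst p + c * snd p, snd p))"
  proof (rule integrable_bounded_mult_compact_support[where C = C and R = "R + \<bar>c\<bar> * R", OF meas2])
    show "continuous_on UNIV (\<lambda>p. h (fst p + c * snd p, snd p))"
      by (rule continuous_on_compose2[OF conth]) (auto intro!: continuous_intros)
    show "h (fst (x, t) + c * snd (x, t), snd (x, t)) = 0"
      if *: "R + \<bar>c\<bar> * R < \<bar>x\<bar> \<or> R + \<bar>c\<bar> * R < \<bar>t\<bar>" for x t
    proof (cases "\<bar>t\<bar> \<le> R")
      case True
      then have "\<bar>c * t\<bar> \<le> \<bar>c\<bar> * R"
        by (simp add: abs_mult mult_left_mono)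
      moreover have "0 \<le> \<bar>c\<bar> * R"
        using R by simp
      ultimately have "R < \<bar>x + c * t\<bar>"
        using * True by linarith
      then show ?thesis using hsupp by simp
    qed (use hsupp in auto)
  qed (use w C in \<open>auto split: split_indicator\<close>)
  have "(LINT p|lborel. (indicator {0<..} (snd p) * w (fst p - c * snd p)) * h p)
      = (LINT t|lborel. LINT x|lborel. indicator {0<..} t * w (x - c * t) * h (x, t))"
    using lborel_pair.integral_snd[of "\<lambda>x t. indicator {0<..} t * w (x - c * t) * h (x, t)"] 1
    by (simp add: lborel_prod case_prod_unfold)
  also have "\<dots> = (LINT t|lborel. LINT y|lborel. indicator {0<..} t * w y * h (y + c * t, t))"
  proof (rule Bochner_Integration.integral_cong[OF refl])
    fix t :: real
    show "(LINT x|lborel. indicator {0<..} t * w (x - c * t) * h (x, t))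
        = (LINT y|lborel. indicator {0<..} t * w y * h (y + c * t, t))"
      by (subst lborel_integral_real_affine[where c = 1 and t = "c * t"]) (auto simp: add.commute)
  qed
  also have "\<dots> = (LINT y|lborel. LINT t|lborel. indicator {0<..} t * w y * h (y + c * t, t))"
    using lborel_pair.Fubini_integral[of "\<lambda>y t. indicator {0<..} t * w y * h (y + c * t, t)"] 2
    by (simp add: lborel_prod case_prod_unfold)
  also have "\<dots> = (LINT y|lborel. w y * (LINT t|lborel. indicator {0<..} t * h (y + c * t, t)))"
    by (simp add: mult.left_commute flip: integral_mult_right_zero) (simp add: mult_ac)
  also have "\<dots> = - (LINT y|lborel. w y * \<phi> y 0)"
    using test_function_line_integral[OF \<phi>, of _ c] by (simp add: h_def)
  finally show "?L = - (LINT y|lborel. w y * \<phi> y 0)"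
    by (simp add: h_def mult_ac)
  from 1 show "integrable lborel (\<lambda>p. indicator {0<..} (snd p) * w (fst p - c * snd p) *
        (\<phi>t (fst p) (snd p) + c * \<phi>x (fst p) (snd p)))"
    by (simp add: h_def mult_ac)
qed

lemma two_contacts_weak_solution:
  fixes c1 c2 a1 a2 :: real
  assumes "c1 \<le> c2"
    and w: "\<And>\<xi>. w \<xi> = (if \<xi> \<le> c1 then a1 else if \<xi> < c2 then 0 else a2)"
    and f: "\<And>\<xi>. f \<xi> = (if \<xi> \<le> c1 then a1 * c1 else if \<xi> < c2 then 0 else a2 * c2)"
  shows "weak_solution (\<lambda>x t. w (x / t)) (\<lambda>x t. f (x / t)) (\<lambda>x. if x < 0 then a1 else a2)"
  unfolding weak_solution_def
proof (intro allI impI)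
  fix \<phi> \<phi>x \<phi>t
  assume \<phi>: "test_function \<phi> \<phi>x \<phi>t"
  obtain R where R: "0 < R"
    "\<And>x t. R < \<bar>x\<bar> \<or> R < \<bar>t\<bar> \<Longrightarrow> \<phi> x t = 0 \<and> \<phi>x x t = 0 \<and> \<phi>t x t = 0"
    by (rule test_function_support[OF \<phi>]) blast
  \<comment> \<open>If \<open>c1 = c2\<close>, the line \<open>x = c1 t\<close> carries the left state only.\<close>
  define w1 w2 :: "real \<Rightarrow> real" where "w1 y = a1 * indicator {..0} y" and "w2 y = a2 * indicator (if c1 < c2 then {0..} else {0<..}) y" for y
  have w1: "w1 \<in> borel_measurable borel" "\<And>y. \<bar>w1 y\<bar> \<le> \<bar>a1\<bar>"
    and w2: "w2 \<in> borel_measurable borel" "\<And>y. \<bar>w2 y\<bar> \<le> \<bar>a2\<bar>"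
    unfolding w1_def w2_def by (auto split: split_indicator)
  note W1 = transport_weak_form[OF \<phi> w1, of c1] and W2 = transport_weak_form[OF \<phi> w2, of c2]
  have cont0: "continuous_on UNIV (\<lambda>x. \<phi> x 0)"
  proof -
    have "continuous_on UNIV (\<lambda>(x, t). \<phi> x t)"
      using \<phi> unfolding test_function_def
      by (auto simp: continuous_on_eq_continuous_at intro!: has_derivative_continuous)
    from continuous_on_compose2[OF this, of UNIV "\<lambda>x. (x, 0)"] show ?thesis
      by (simp add: continuous_on_Pair)
  qed
  have int0: "integrable lborel (\<lambda>y. v y * \<phi> y 0)"
    if [measurable]: "v \<in> borel_measurable borel" and v: "\<And>y. \<bar>v y\<bar> \<le> C" for v :: "real \<Rightarrow> real" and C
  proof -
    have "set_integrable lborel {-R..R} (\<lambda>y. \<phi> y 0)"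
      by (rule borel_integrable_atLeastAtMost'[OF continuous_on_subset[OF cont0]]) auto
    then have *: "integrable lborel (\<lambda>y. C * (indicator {-R..R} y * \<phi> y 0))"
      unfolding set_integrable_def by auto
    have [measurable]: "(\<lambda>y. \<phi> y 0) \<in> borel_measurable borel"
      using cont0 by (rule borel_measurable_continuous_onI)
    show ?thesis
    proof (rule Bochner_Integration.integrable_bound[OF *])
      show "AE y in lborel. norm (v y * \<phi> y 0) \<le> norm (C * (indicator {-R..R} y * \<phi> y 0))"
      proof (intro always_eventually allI)
        fix y
        show "norm (v y * \<phi> y 0) \<le> norm (C * (indicator {-R..R} y * \<phi> y 0))"
          using R(2)[of y 0] v[of y]
          by (cases "\<bar>y\<bar> \<le> R") (auto simp: abs_mult indicator_def intro!: mult_right_mono)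
      qed
    qed simp
  qed
  have "(LINT p:UNIV \<times> {0<..}|lborel. (case p of (x, t) \<Rightarrow> w (x / t) * \<phi>t x t + f (x / t) * \<phi>x x t))
    = (LINT p|lborel. indicator {0<..} (snd p) * w1 (fst p - c1 * snd p) *
        (\<phi>t (fst p) (snd p) + c1 * \<phi>x (fst p) (snd p)) +
        indicator {0<..} (snd p) * w2 (fst p - c2 * snd p) *
        (\<phi>t (fst p) (snd p) + c2 * \<phi>x (fst p) (snd p)))"
    unfolding set_lebesgue_integral_def
  proof (rule Bochner_Integration.integral_cong[OF refl])
    fix p :: "real \<times> real"
    obtain x t where p: "p = (x, t)"
      by force
    show "indicator (UNIV \<times> {0<..}) p *\<^sub>R
        (case p of (x, t) \<Rightarrow> w (x / t) * \<phi>t x t + f (x / t) * \<phi>x x t) =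
      indicator {0<..} (snd p) * w1 (fst p - c1 * snd p) *
        (\<phi>t (fst p) (snd p) + c1 * \<phi>x (fst p) (snd p)) +
        indicator {0<..} (snd p) * w2 (fst p - c2 * snd p) *
        (\<phi>t (fst p) (snd p) + c2 * \<phi>x (fst p) (snd p))"
    proof (cases "0 < t")
      case True
      then have "x - c1 * t \<le> 0 \<longleftrightarrow> x / t \<le> c1" "0 \<le> x - c2 * t \<longleftrightarrow> \<not> x / t < c2"
        "0 < x - c2 * t \<longleftrightarrow> c2 < x / t"
        by (auto simp: field_simps)
      then have "w (x / t) = w1 (x - c1 * t) + w2 (x - c2 * t)"
        "f (x / t) = c1 * w1 (x - c1 * t) + c2 * w2 (x - c2 * t)"
        using \<open>c1 \<le> c2\<close> by (auto simp: w f w1_def w2_def indicator_def)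
      then show ?thesis
        using True by (simp add: p algebra_simps)
    qed (simp add: p)
  qed
  also have "\<dots> = - (LINT y|lborel. w1 y * \<phi> y 0) + - (LINT y|lborel. w2 y * \<phi> y 0)"
    by (simp add: W1 W2)
  also have "\<dots> = - (LINT y|lborel. w1 y * \<phi> y 0 + w2 y * \<phi> y 0)"
    using int0[OF w1] int0[OF w2] by simp
  \<comment> \<open>At \<open>t = 0\<close> the two half-line pieces join to the Riemann data,
    except possibly at the origin.\<close>
  also have "(LINT y|lborel. w1 y * \<phi> y 0 + w2 y * \<phi> y 0) = (LINT x|lborel. (if x < 0 then a1 else a2) * \<phi> x 0)"
  proof (rule integral_cong_AE)
    note [measurable] = w1(1) w2(1) borel_measurable_continuous_onI[OF cont0]
    show "(\<lambda>y. w1 y * \<phi> y 0 + w2 y * \<phi> y 0) \<in> borel_measurable lborel"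
      "(\<lambda>x. (if x < 0 then a1 else a2) * \<phi> x 0) \<in> borel_measurable lborel"
      by measurable
    show "AE x in lborel. w1 x * \<phi> x 0 + w2 x * \<phi> x 0 = (if x < 0 then a1 else a2) * \<phi> x 0"
      using AE_lborel_singleton[of 0] by eventually_elim (auto simp: w1_def w2_def indicator_def)
  qed
  finally show "(LINT p:UNIV \<times> {0<..}|lborel. (case p of (x, t) \<Rightarrow> w (x / t) * \<phi>t x t + f (x / t) * \<phi>x x t))
      + (LBINT x. (if x < 0 then a1 else a2) * \<phi> x 0) = 0"
    by simp
qed

subsection \<open>Self-similar weak solutions\<close>

text \<open>Squaring removes the kink of \<open>max 0\<close>: at 0 the difference quotient is
  \<open>max 0 h\<close>. The bump and the smoothed ramps below are built from this
  function.\<close>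

lemma DERIV_pos_part_square: "((\<lambda>y::real. (max 0 y)\<^sup>2) has_real_derivative 2 * max 0 y) (at y)"
proof -
  consider "y < 0" | "y = 0" | "0 < y"
    by linarith
  then show ?thesis
  proof cases
    case 1
    have "((\<lambda>y::real. (max 0 y)\<^sup>2) has_real_derivative 0) (at y)"
      by (rule has_field_derivative_transform_within_open[OF DERIV_const, where S = "{..<0}"])
        (use 1 in auto)
    then show ?thesis using 1 by simp
  next
    case 2
    have "(\<lambda>h::real. max 0 h) \<midarrow>0\<rightarrow> max 0 0"
      by (intro tendsto_intros)
    then have "(\<lambda>h::real. ((max 0 (0 + h))\<^sup>2 - (max 0 0)\<^sup>2) / h) \<midarrow>0\<rightarrow> max 0 0"
      by (rule Lim_transform_eventually)
        (auto simp: eventually_at_filter power2_eq_square max_def intro!: always_eventually)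
    then show ?thesis using 2 by (simp add: DERIV_def)
  next
    case 3
    have "((\<lambda>y::real. (max 0 y)\<^sup>2) has_real_derivative 2 * y) (at y)"
      by (rule has_field_derivative_transform_within_open[where f = "\<lambda>y. y\<^sup>2" and S = "{0<..}"])
        (use 3 in \<open>auto intro!: derivative_eq_intros\<close>)
    then show ?thesis using 3 by simp
  qed
qed

text \<open>The polynomial \<open>(1 - y\<^sup>2)\<^sup>2\<close> cut off outside
  \<open>[-1, 1]\<close>. It is just smooth enough for \<open>test_function\<close> and has an
  explicit integral.\<close>

definition bump :: "real \<Rightarrow> real" where
  "bump y = (max 0 (1 - y\<^sup>2))\<^sup>2"

definition bump' :: "real \<Rightarrow> real" where
  "bump' y = - 4 * y * max 0 (1 - y\<^sup>2)"

lemma bump_eq_0: "1 \<le> \<bar>y\<bar> \<Longrightarrow> bump y = 0" "1 \<le> \<bar>y\<bar> \<Longrightarrow> bump' y = 0"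
proof -
  assume "1 \<le> \<bar>y\<bar>"
  then have "1\<^sup>2 \<le> y\<^sup>2" by (intro abs_le_square_iff[THEN iffD1]) auto
  then show "bump y = 0" "bump' y = 0" by (auto simp: bump_def bump'_def)
qed

lemma DERIV_bump: "(bump has_real_derivative bump' y) (at y)"
proof -
  have "((\<lambda>y. 1 - y\<^sup>2) has_real_derivative - 2 * y) (at y)"
    by (auto intro!: derivative_eq_intros)
  from DERIV_chain2[OF DERIV_pos_part_square this] show ?thesis
    by (simp add: bump_def[abs_def] bump'_def mult_ac)
qed

lemma continuous_on_bump: "continuous_on S bump" "continuous_on S bump'"
  unfolding bump_def bump'_def by (intro continuous_intros)+

lemma continuous_on_bump_compose [continuous_intros]:
  assumes "continuous_on S f"
  shows "continuous_on S (\<lambda>x. bump (f x))" "continuous_on S (\<lambda>x. bump' (f x))"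
  by (rule continuous_on_compose2[OF continuous_on_bump(1)[of UNIV] assms], simp)
    (rule continuous_on_compose2[OF continuous_on_bump(2)[of UNIV] assms], simp)

text \<open>What matters later is that the value is nonzero, so that it can be cancelled from weak
  identities.\<close>

lemma integral_bump: "integrable lborel bump" "(LINT y|lborel. bump y) = 16 / 15"
proof -
  have eq: "bump = (\<lambda>y. (1 - y\<^sup>2)\<^sup>2 * indicator {-1..1} y)"
  proof
    fix y
    show "bump y = (1 - y\<^sup>2)\<^sup>2 * indicator {-1..1} y"
      using bump_eq_0(1)[of y] abs_square_le_1[of y]
      by (cases "\<bar>y\<bar> \<le> 1") (auto simp: bump_def indicator_def abs_le_iff)
  qed
  have "has_bochner_integral lborel (\<lambda>y. (1 - y\<^sup>2)\<^sup>2 * indicator {-1..1} y)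
      ((1 - 2 * 1 ^ 3 / 3 + 1 ^ 5 / 5) - ((-1) - 2 * (-1) ^ 3 / 3 + (-1) ^ 5 / 5 :: real))"
    by (rule has_bochner_integral_FTC_Icc_real[where F = "\<lambda>y. y - 2 * y ^ 3 / 3 + y ^ 5 / 5"])
      (auto intro!: derivative_eq_intros simp: power2_eq_square power4_eq_xxxx algebra_simps)
  then show "integrable lborel bump" "(LINT y|lborel. bump y) = 16 / 15"
    unfolding eq by (auto simp: has_bochner_integral_iff)
qed

lemma integral_bump_shift:
  "integrable lborel (\<lambda>y. bump (y - a))" "(LINT y|lborel. bump (y - a)) = 16 / 15"
  using lborel_integrable_real_affine[OF integral_bump(1), of 1 "- a"] integral_bump(2)
    lborel_integral_real_affine[of 1 bump "- a"] by (auto simp: add.commute)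

lemma integral_deriv_compact_support:
  fixes G g :: "real \<Rightarrow> real"
  assumes d: "\<And>x. (G has_real_derivative g x) (at x)" and cont: "continuous_on UNIV g"
    and supp: "\<And>x. R < \<bar>x\<bar> \<Longrightarrow> G x = 0 \<and> g x = 0"
  shows "has_bochner_integral lborel g 0"
proof -
  let ?S = "\<bar>R\<bar> + 1"
  have "g = (\<lambda>x. g x * indicator {- ?S..?S} x)"
  proof
    fix x
    show "g x = g x * indicator {- ?S..?S} x"
      using supp[of x] by (cases "R < \<bar>x\<bar>") (auto simp: indicator_def)
  qed
  moreover have "has_bochner_integral lborel (\<lambda>x. g x * indicator {- ?S..?S} x) (G ?S - G (- ?S))"
    using d cont by (intro has_bochner_integral_FTC_Icc_real) (auto simp: continuous_on_eq_continuous_at)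
  ultimately show ?thesis
    using supp by simp
qed

lemma integrable_locally_bounded_mult:
  fixes g h :: "real \<Rightarrow> real"
  assumes [measurable]: "g \<in> borel_measurable borel" "h \<in> borel_measurable borel"
    and g: "\<And>x. \<bar>x\<bar> \<le> R \<Longrightarrow> \<bar>g x\<bar> \<le> C" and h: "\<And>x. \<bar>h x\<bar> \<le> D"
    and supp: "\<And>x. R < \<bar>x\<bar> \<Longrightarrow> h x = 0"
  shows "integrable lborel (\<lambda>x. g x * h x)"
proof (rule integrableI_bounded_set[where A = "{-R..R}" and B = "C * D"])
  show "AE x in lborel. x \<in> {-R..R} \<longrightarrow> norm (g x * h x) \<le> C * D"
    using g h by (intro always_eventually allI impI)
      (auto simp: abs_mult intro!: mult_mono')
  show "AE x in lborel. x \<notin> {-R..R} \<longrightarrow> g x * h x = 0"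
    using supp by (intro always_eventually) (auto simp: not_le)
qed (auto simp: emeasure_lborel_Icc_eq)

section \<open>Self-similar weak forms as integrals over \<open>\<xi>\<close>\<close>

text \<open>Substituting \<open>x = \<xi> * t\<close> at each fixed \<open>t > 0\<close> costs a
  factor \<open>t\<close> and leaves \<open>w\<close> and \<open>f\<close> as functions of
  \<open>\<xi>\<close> alone.\<close>

lemma self_similar_integral:
  fixes w f :: "real \<Rightarrow> real"
  assumes \<phi>: "test_function \<phi> \<phi>x \<phi>t"
    and [measurable]: "w \<in> borel_measurable borel" "f \<in> borel_measurable borel"
    and bdd: "\<And>y. \<bar>w y\<bar> \<le> C" "\<And>y. \<bar>f y\<bar> \<le> C"
  shows "(LINT p:UNIV \<times> {0<..}|lborel. (case p of (x, t) \<Rightarrow> w (x / t) * \<phi>t x t + f (x / t) * \<phi>x x t))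
    = (LINT t|lborel. indicator {0<..} t *
        (t * (LINT \<xi>|lborel. w \<xi> * \<phi>t (\<xi> * t) t + f \<xi> * \<phi>x (\<xi> * t) t)))"
proof -
  obtain R where R: "0 < R"
    "\<And>x t. R < \<bar>x\<bar> \<or> R < \<bar>t\<bar> \<Longrightarrow> \<phi> x t = 0 \<and> \<phi>x x t = 0 \<and> \<phi>t x t = 0"
    by (rule test_function_support[OF \<phi>]) blast
  have cont: "continuous_on UNIV (\<lambda>p. \<phi>x (fst p) (snd p))" "continuous_on UNIV (\<lambda>p. \<phi>t (fst p) (snd p))"
    using \<phi> unfolding test_function_def case_prod_unfold by auto
  have int: "integrable lborel (\<lambda>p. (indicator {0<..} (snd p) * g (fst p / snd p)) * h (fst p) (snd p))"
    if [measurable]: "g \<in> borel_measurable borel" and g: "\<And>y. \<bar>g y\<bar> \<le> C"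
      and h: "continuous_on UNIV (\<lambda>p. h (fst p) (snd p))"
      and supp: "\<And>x t. R < \<bar>x\<bar> \<or> R < \<bar>t\<bar> \<Longrightarrow> h x t = 0" for g :: "real \<Rightarrow> real" and h
  proof (rule integrable_bounded_mult_compact_support[OF _ _ h, where C = C and R = R])
    show "(\<lambda>p. indicator {0<..} (snd p) * g (fst p / snd p)) \<in> borel_measurable borel"
      unfolding borel_prod[symmetric] by measurable
    show "\<bar>indicator {0<..} (snd p) * g (fst p / snd p)\<bar> \<le> C" for p
      using g[of "fst p / snd p"] order_trans[OF abs_ge_zero g[of 0]] by (auto simp: indicator_def)
  qed (use supp in auto)
  have eq: "indicator (UNIV \<times> {0<..}) p *\<^sub>R (case p of (x, t) \<Rightarrow> w (x / t) * \<phi>t x t + f (x / t) * \<phi>x x t)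
      = (case p of (x, t) \<Rightarrow> indicator {0<..} t * (w (x / t) * \<phi>t x t + f (x / t) * \<phi>x x t))" for p
    by (auto simp: indicator_def split: prod.splits)
  have "integrable lborel (\<lambda>(x, t). indicator {0<..} t * (w (x / t) * \<phi>t x t + f (x / t) * \<phi>x x t))"
    using Bochner_Integration.integrable_add[OF int[of w \<phi>t] int[of f \<phi>x]] bdd cont R
    by (simp add: case_prod_unfold algebra_simps)
  then have "(LINT p|lborel. (case p of (x, t) \<Rightarrow> indicator {0<..} t * (w (x / t) * \<phi>t x t + f (x / t) * \<phi>x x t)))
      = (LINT t|lborel. LINT x|lborel. indicator {0<..} t * (w (x / t) * \<phi>t x t + f (x / t) * \<phi>x x t))"
    using lborel_pair.integral_snd[of "\<lambda>x t. indicator {0<..} t * (w (x / t) * \<phi>t x t + f (x / t) * \<phi>x x t)"]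
    by (simp add: lborel_prod)
  also have "\<dots> = (LINT t|lborel. indicator {0<..} t *
        (t * (LINT \<xi>|lborel. w \<xi> * \<phi>t (\<xi> * t) t + f \<xi> * \<phi>x (\<xi> * t) t)))"
  proof (rule Bochner_Integration.integral_cong[OF refl])
    fix t :: real
    show "(LINT x|lborel. indicator {0<..} t * (w (x / t) * \<phi>t x t + f (x / t) * \<phi>x x t))
      = indicator {0<..} t * (t * (LINT \<xi>|lborel. w \<xi> * \<phi>t (\<xi> * t) t + f \<xi> * \<phi>x (\<xi> * t) t))"
    proof (cases "0 < t")
      case True
      then show ?thesis
        by (subst lborel_integral_real_affine[where c = t and t = 0]) (auto simp: mult.commute)
    qed simp
  qed
  finally show ?thesis
    unfolding set_lebesgue_integral_def eq .
qed

text \<open>A null set of \<open>\<xi>\<close> corresponds to a cone of rays in the half-plane. Once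
  the weak form consists of inner integrals over \<open>\<xi>\<close>, it is an ordinary null set on
  the line, invisible to each of them.\<close>

lemma weak_solution_AE_cong:
  fixes w f w' f' :: "real \<Rightarrow> real"
  assumes [measurable]: "w \<in> borel_measurable borel" "f \<in> borel_measurable borel"
      "w' \<in> borel_measurable borel" "f' \<in> borel_measurable borel"
    and bdd: "\<And>y. \<bar>w y\<bar> \<le> C" "\<And>y. \<bar>f y\<bar> \<le> C" "\<And>y. \<bar>w' y\<bar> \<le> C'" "\<And>y. \<bar>f' y\<bar> \<le> C'"
    and AE: "AE \<xi> in lborel. w \<xi> = w' \<xi> \<and> f \<xi> = f' \<xi>"
    and sol: "weak_solution (\<lambda>x t. w (x / t)) (\<lambda>x t. f (x / t)) w0"
  shows "weak_solution (\<lambda>x t. w' (x / t)) (\<lambda>x t. f' (x / t)) w0"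
  unfolding weak_solution_def
proof (intro allI impI)
  fix \<phi> \<phi>x \<phi>t
  assume \<phi>: "test_function \<phi> \<phi>x \<phi>t"
  have "(LINT \<xi>|lborel. w \<xi> * \<phi>t (\<xi> * t) t + f \<xi> * \<phi>x (\<xi> * t) t)
      = (LINT \<xi>|lborel. w' \<xi> * \<phi>t (\<xi> * t) t + f' \<xi> * \<phi>x (\<xi> * t) t)" for t
  proof (rule integral_cong_AE)
    have "continuous_on UNIV (\<lambda>(x, t). \<phi>x x t)" "continuous_on UNIV (\<lambda>(x, t). \<phi>t x t)"
      using \<phi> unfolding test_function_def by auto
    from this[THEN continuous_on_compose2, of UNIV "\<lambda>\<xi>. (\<xi> * t, t)"]
    have "continuous_on UNIV (\<lambda>\<xi>. \<phi>x (\<xi> * t) t)" "continuous_on UNIV (\<lambda>\<xi>. \<phi>t (\<xi> * t) t)"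
      by (simp_all add: continuous_on_Pair continuous_on_mult_right)
    note [measurable] = this[THEN borel_measurable_continuous_onI]
    show "(\<lambda>\<xi>. w \<xi> * \<phi>t (\<xi> * t) t + f \<xi> * \<phi>x (\<xi> * t) t) \<in> borel_measurable lborel"
      "(\<lambda>\<xi>. w' \<xi> * \<phi>t (\<xi> * t) t + f' \<xi> * \<phi>x (\<xi> * t) t) \<in> borel_measurable lborel"
      by measurable
    show "AE \<xi> in lborel. w \<xi> * \<phi>t (\<xi> * t) t + f \<xi> * \<phi>x (\<xi> * t) t =
        w' \<xi> * \<phi>t (\<xi> * t) t + f' \<xi> * \<phi>x (\<xi> * t) t"
      using AE by eventually_elim simp
  qed
  then have "(LINT p:UNIV \<times> {0<..}|lborel. (case p of (x, t) \<Rightarrow> w (x / t) * \<phi>t x t + f (x / t) * \<phi>x x t))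
    = (LINT p:UNIV \<times> {0<..}|lborel. (case p of (x, t) \<Rightarrow> w' (x / t) * \<phi>t x t + f' (x / t) * \<phi>x x t))"
    using self_similar_integral[OF \<phi>, of w f C] self_similar_integral[OF \<phi>, of w' f' C'] bdd
    by simp
  then show "(LINT p:UNIV \<times> {0<..}|lborel. (case p of (x, t) \<Rightarrow> w' (x / t) * \<phi>t x t + f' (x / t) * \<phi>x x t))
      + (LBINT x. w0 x * \<phi> x 0) = 0"
    using sol[unfolded weak_solution_def, rule_format, OF \<phi>] by simp
qed

text \<open>Being centred at \<open>(a, 0)\<close>, these functions do not vanish on the initial
  line and can read off the initial data.\<close>

lemma test_function_bump:
  "test_function (\<lambda>x t. bump (x - a) * bump t) (\<lambda>x t. bump' (x - a) * bump t) (\<lambda>x t. bump (x - a) * bump' t)"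
  unfolding test_function_def
proof (intro conjI allI exI[of _ "cbox (a - 1, -1) (a + 1, 1)"])
  fix x t :: real
  have "((\<lambda>p. fst p - a) has_derivative fst) (at (x, t))"
    by (rule has_derivative_eq_rhs, (rule derivative_intros)+) simp
  from has_derivative_compose[OF this DERIV_bump[unfolded has_field_derivative_def]]
  have "((\<lambda>p. bump (fst p - a)) has_derivative (\<lambda>q. bump' (fst (x, t) - a) * fst q)) (at (x, t))" .
  moreover have "(snd has_derivative snd) (at (x, t))"
    by (rule has_derivative_snd[OF has_derivative_ident])
  from has_derivative_compose[OF this DERIV_bump[unfolded has_field_derivative_def]]
  have "((\<lambda>p. bump (snd p)) has_derivative (\<lambda>q. bump' (snd (x, t)) * snd q)) (at (x, t))" .
  ultimately have "((\<lambda>p. bump (fst p - a) * bump (snd p)) has_derivative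
      (\<lambda>q. bump (fst (x, t) - a) * (bump' (snd (x, t)) * snd q)
        + bump' (fst (x, t) - a) * fst q * bump (snd (x, t)))) (at (x, t))"
    by (rule has_derivative_mult)
  then show "((\<lambda>(x, t). bump (x - a) * bump t) has_derivative
      (\<lambda>(h, k). bump' (x - a) * bump t * h + bump (x - a) * bump' t * k)) (at (x, t))"
    by (simp add: case_prod_unfold algebra_simps)
next
  show "continuous_on UNIV (\<lambda>(x, t). bump' (x - a) * bump t)"
    "continuous_on UNIV (\<lambda>(x, t). bump (x - a) * bump' t)"
    unfolding case_prod_unfold
    by (intro continuous_intros)+
next
  fix x t :: real
  show "(x, t) \<notin> cbox (a - 1, -1) (a + 1, 1) \<longrightarrow> bump (x - a) * bump t = 0"
    using bump_eq_0(1)[of t] bump_eq_0(1)[of "x - a"] by (auto simp: cbox_Pair_eq not_le)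
qed (rule compact_cbox)

text \<open>Both weak forms contain the same space-time integral, so their initial terms agree.
  Bumps centred at \<open>-1\<close> and \<open>1\<close> live on one half-line each and see a
  single constant.\<close>

lemma weak_solution_initial_unique:
  fixes a b a' b' :: real
  assumes "weak_solution w f (\<lambda>x. if x < 0 then a else b)"
    and "weak_solution w f (\<lambda>x. if x < 0 then a' else b')"
  shows "a = a'" "b = b'"
proof -
  have eq: "(LBINT x. (if x < 0 then a else b) * (bump (x - c) * bump 0))
      = (LBINT x. (if x < 0 then a' else b') * (bump (x - c) * bump 0))" for c
    using assms(1)[unfolded weak_solution_def, rule_format, OF test_function_bump[of c]]
      assms(2)[unfolded weak_solution_def, rule_format, OF test_function_bump[of c]] by linarith
  have neg: "(if x < 0 then a else b) * (bump (x - (-1)) * bump 0) = a * bump (x - (-1))" for a b x :: real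
    using bump_eq_0(1)[of "x - (-1)"] by (auto simp: bump_def[of 0])
  have pos: "(if x < 0 then a else b) * (bump (x - 1) * bump 0) = b * bump (x - 1)" for a b x :: real
    using bump_eq_0(1)[of "x - 1"] by (auto simp: bump_def[of 0])
  show "a = a'" "b = b'"
    using eq[of "-1"] eq[of 1] unfolding neg pos integral_mult_right_zero integral_bump_shift by auto
qed

section \<open>The weak ordinary differential equation in \<open>\<xi>\<close>\<close>

text \<open>The factor \<open>bump (t - 2)\<close> lives on \<open>1 \<le> t \<le> 3\<close>, away
  from the singularity of \<open>x / t\<close>. For \<open>t > 0\<close> the usual rules apply, for
  \<open>t < 1\<close> everything is 0, and these two open half-planes cover the plane.\<close>

lemma test_function_self_similar:
  assumes d: "\<And>x. (\<Theta> has_real_derivative \<theta> x) (at x)" and cont: "continuous_on UNIV \<theta>"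
    and supp: "\<And>x. R < \<bar>x\<bar> \<Longrightarrow> \<Theta> x = 0"
  shows "test_function (\<lambda>x t. \<Theta> (x / t) * bump (t - 2)) (\<lambda>x t. \<theta> (x / t) / t * bump (t - 2))
    (\<lambda>x t. - x / t\<^sup>2 * \<theta> (x / t) * bump (t - 2) + \<Theta> (x / t) * bump' (t - 2))"
  unfolding test_function_def
\<comment> \<open>On the support \<open>\<bar>x\<bar> \<le> \<bar>R\<bar> * t\<close> and
  \<open>t \<le> 3\<close>, hence the half-width \<open>3 * \<bar>R\<bar>\<close>.\<close>
proof (intro conjI allI exI[of _ "cbox (- 3 * \<bar>R\<bar>, 1) (3 * \<bar>R\<bar>, 3)"])
  have open01: "open (UNIV \<times> {0<..} :: (real \<times> real) set)" "open (UNIV \<times> {..<1} :: (real \<times> real) set)"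
    by (auto intro: open_Times)
  have cover: "UNIV \<times> {0<..} \<union> UNIV \<times> {..<1} = (UNIV :: (real \<times> real) set)"
    by auto
  have cont\<Theta>: "continuous_on UNIV \<Theta>"
    using d by (auto simp: continuous_on_eq_continuous_at intro: DERIV_isCont)
  fix x t :: real
  show "((\<lambda>(x, t). \<Theta> (x / t) * bump (t - 2)) has_derivative
      (\<lambda>(h, k). \<theta> (x / t) / t * bump (t - 2) * h +
        (- x / t\<^sup>2 * \<theta> (x / t) * bump (t - 2) + \<Theta> (x / t) * bump' (t - 2)) * k)) (at (x, t))"
  proof (cases "0 < t")
    case True
    have "((\<lambda>p. fst p / snd p) has_derivative (\<lambda>q. - fst (x, t) * (inverse (snd (x, t)) * snd q * inverse (snd (x, t)))
        + fst q / snd (x, t))) (at (x, t))"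
      using True by (intro has_derivative_divide derivative_intros) auto
    from has_derivative_compose[OF this d[unfolded has_field_derivative_def]]
    have 1: "((\<lambda>p. \<Theta> (fst p / snd p)) has_derivative
        (\<lambda>q. \<theta> (x / t) * (- x * (inverse t * snd q * inverse t) + fst q / t))) (at (x, t))"
      by simp
    have "((\<lambda>p. snd p - 2) has_derivative snd) (at (x, t))"
      by (auto intro!: derivative_eq_intros)
    from has_derivative_compose[OF this DERIV_bump[unfolded has_field_derivative_def]]
    have 2: "((\<lambda>p. bump (snd p - 2)) has_derivative (\<lambda>q. bump' (t - 2) * snd q)) (at (x, t))"
      by simp
    have eq: "(\<lambda>q. \<Theta> (x / t) * (bump' (t - 2) * snd q) +
          \<theta> (x / t) * (- x * (inverse t * snd q * inverse t) + fst q / t) * bump (t - 2))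
        = (\<lambda>(h, k). \<theta> (x / t) / t * bump (t - 2) * h +
          (- x / t\<^sup>2 * \<theta> (x / t) * bump (t - 2) + \<Theta> (x / t) * bump' (t - 2)) * k)"
      using True by (auto simp: field_simps power2_eq_square)
    show ?thesis
      using has_derivative_mult[OF 1 2] by (simp only: fst_conv snd_conv eq case_prod_unfold)
  next
    case False
    then have zero: "bump (t - 2) = 0" "bump' (t - 2) = 0"
      by (auto intro!: bump_eq_0)
    have "((\<lambda>(x, t). \<Theta> (x / t) * bump (t - 2)) has_derivative (\<lambda>_. 0)) (at (x, t))"
      by (rule has_derivative_transform_within_open[OF has_derivative_const open01(2)])
        (use False in \<open>auto simp: bump_eq_0\<close>)
    then show ?thesis
      by (simp add: zero case_prod_unfold)
  qed
  show "(x, t) \<notin> cbox (- 3 * \<bar>R\<bar>, 1) (3 * \<bar>R\<bar>, 3) \<longrightarrow> \<Theta> (x / t) * bump (t - 2) = 0"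
  proof (intro impI, rule ccontr)
    assume notin: "(x, t) \<notin> cbox (- 3 * \<bar>R\<bar>, 1) (3 * \<bar>R\<bar>, 3)" and "\<Theta> (x / t) * bump (t - 2) \<noteq> 0"
    then have "\<bar>x / t\<bar> \<le> \<bar>R\<bar>" "\<bar>t - 2\<bar> < 1"
      using supp[of "x / t"] bump_eq_0(1)[of "t - 2"] by force+
    then have t: "1 < t" "t < 3" and "\<bar>x\<bar> \<le> \<bar>R\<bar> * t"
      by (auto simp: abs_less_iff field_simps)
    moreover have "\<bar>R\<bar> * t \<le> \<bar>R\<bar> * 3"
      using t by (intro mult_left_mono) auto
    ultimately show False
      using notin by (auto simp: cbox_Pair_eq)
  qed
  have "continuous_on (UNIV \<times> {0<..}) (\<lambda>p. \<theta> (fst p / snd p) / snd p * bump (snd p - 2))"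
    "continuous_on (UNIV \<times> {0<..}) (\<lambda>p. - fst p / (snd p)\<^sup>2 * \<theta> (fst p / snd p) * bump (snd p - 2)
        + \<Theta> (fst p / snd p) * bump' (snd p - 2))"
    by (intro continuous_intros continuous_on_compose2[OF cont] continuous_on_compose2[OF cont\<Theta>];
        force)+
  moreover have "continuous_on (UNIV \<times> {..<1}) (\<lambda>p. \<theta> (fst p / snd p) / snd p * bump (snd p - 2))"
    "continuous_on (UNIV \<times> {..<1}) (\<lambda>p. - fst p / (snd p)\<^sup>2 * \<theta> (fst p / snd p) * bump (snd p - 2)
        + \<Theta> (fst p / snd p) * bump' (snd p - 2))"
    by (rule continuous_on_eq[OF continuous_on_const[of _ 0]]; auto simp: bump_eq_0)+
  ultimately show "continuous_on UNIV (\<lambda>(x, t). \<theta> (x / t) / t * bump (t - 2))"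
    "continuous_on UNIV (\<lambda>(x, t). - x / t\<^sup>2 * \<theta> (x / t) * bump (t - 2) + \<Theta> (x / t) * bump' (t - 2))"
    using continuous_on_open_Un[OF open01] unfolding cover case_prod_unfold by blast+
qed (rule compact_cbox)

text \<open>This is the weak form of \<open>(f - \<xi> * w)' = - w\<close>. With a test function
  that is a product in the variables \<open>\<xi>\<close> and \<open>t\<close>, the weak equation
  becomes a nonzero multiple of the difference of the two sides.\<close>

lemma weak_solution_self_similar_ode:
  fixes w f \<Theta> \<theta> :: "real \<Rightarrow> real"
  assumes sol: "weak_solution (\<lambda>x t. w (x / t)) (\<lambda>x t. f (x / t)) w0"
    and [measurable]: "w \<in> borel_measurable borel" "f \<in> borel_measurable borel"
    and bdd: "\<And>y. \<bar>w y\<bar> \<le> C" "\<And>y. \<bar>f y\<bar> \<le> C"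
    and d: "\<And>x. (\<Theta> has_real_derivative \<theta> x) (at x)" and cont: "continuous_on UNIV \<theta>"
    and supp: "\<And>x. R < \<bar>x\<bar> \<Longrightarrow> \<Theta> x = 0 \<and> \<theta> x = 0"
  shows "(LINT \<xi>|lborel. (f \<xi> - \<xi> * w \<xi>) * \<theta> \<xi>) = (LINT \<xi>|lborel. w \<xi> * \<Theta> \<xi>)" (is "?a = ?b")
proof -
  have cont\<Theta>: "continuous_on UNIV \<Theta>"
    using d by (auto simp: continuous_on_eq_continuous_at intro: DERIV_isCont)
  note [measurable] = cont\<Theta>[THEN borel_measurable_continuous_onI] cont[THEN borel_measurable_continuous_onI]
  have bounded: "\<exists>D. \<forall>x. \<bar>h x\<bar> \<le> D"
    if "continuous_on UNIV h" "\<And>x. R < \<bar>x\<bar> \<Longrightarrow> h x = 0" for h :: "real \<Rightarrow> real"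
  proof -
    have "bounded (h ` {-R..R})"
      using that by (intro compact_imp_bounded compact_continuous_image) (auto intro: continuous_on_subset)
    then obtain D where D: "0 < D" "\<forall>y \<in> h ` {-R..R}. norm y \<le> D"
      unfolding bounded_pos by blast
    have "\<bar>h x\<bar> \<le> D" for x
    proof (cases "R < \<bar>x\<bar>")
      case False
      then have "h x \<in> h ` {-R..R}"
        by (intro imageI) auto
      then show ?thesis
        using D(2) by auto
    qed (use that(2) D(1) in auto)
    then show ?thesis by blast
  qed
  obtain D1 where D1: "\<And>x. \<bar>\<Theta> x\<bar> \<le> D1"
    using bounded[OF cont\<Theta>] supp by blast
  obtain D2 where D2: "\<And>x. \<bar>\<theta> x\<bar> \<le> D2"
    using bounded[OF cont] supp by blast
  have int: "integrable lborel (\<lambda>\<xi>. (f \<xi> - \<xi> * w \<xi>) * \<theta> \<xi>)"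
  proof (rule integrable_locally_bounded_mult[where R = R and D = D2 and C = "C + \<bar>R\<bar> * C"])
    show "\<bar>f x - x * w x\<bar> \<le> C + \<bar>R\<bar> * C" if "\<bar>x\<bar> \<le> R" for x
    proof -
      have "\<bar>x * w x\<bar> \<le> \<bar>R\<bar> * C"
        unfolding abs_mult using that bdd by (intro mult_mono) auto
      then show ?thesis using bdd(2)[of x] by linarith
    qed
  qed (use D2 supp in auto)
  have int': "integrable lborel (\<lambda>\<xi>. w \<xi> * \<Theta> \<xi>)"
    by (rule integrable_locally_bounded_mult[where R = R and D = D1 and C = C]) (use D1 bdd supp in auto)
  \<comment> \<open>The derivative of \<open>t * bump (t - 2)\<close>, so its integral is 0.\<close>
  define X where "X t = bump (t - 2) + t * bump' (t - 2)" for t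
  have X: "has_bochner_integral lborel X 0"
  proof (rule integral_deriv_compact_support[where G = "\<lambda>t. t * bump (t - 2)" and R = 3])
    show "((\<lambda>t. t * bump (t - 2)) has_real_derivative X t) (at t)" for t
      unfolding X_def by (auto intro!: derivative_eq_intros DERIV_chain2[OF DERIV_bump])
    show "continuous_on UNIV X"
      unfolding X_def
      by (intro continuous_intros)
    show "t * bump (t - 2) = 0 \<and> X t = 0" if "3 < \<bar>t\<bar>" for t
    proof -
      have "1 \<le> \<bar>t - 2\<bar>" using that by linarith
      then show ?thesis unfolding X_def by (simp add: bump_eq_0)
    qed
  qed
  define \<phi>t where "\<phi>t x t = - x / t\<^sup>2 * \<theta> (x / t) * bump (t - 2) + \<Theta> (x / t) * bump' (t - 2)" for x t
  define \<phi>x where "\<phi>x x t = \<theta> (x / t) / t * bump (t - 2)" for x t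
  have \<phi>: "test_function (\<lambda>x t. \<Theta> (x / t) * bump (t - 2)) \<phi>x \<phi>t"
    unfolding \<phi>t_def[abs_def] \<phi>x_def[abs_def]
    by (rule test_function_self_similar[OF d cont]) (use supp in auto)
  \<comment> \<open>There is no initial term, because \<open>bump (t - 2)\<close> vanishes at
    \<open>t = 0\<close>.\<close>
  have "0 = (LINT t|lborel. indicator {0<..} t *
        (t * (LINT \<xi>|lborel. w \<xi> * \<phi>t (\<xi> * t) t + f \<xi> * \<phi>x (\<xi> * t) t)))"
    using sol \<phi> self_similar_integral[OF \<phi>, of w f C] bdd
    unfolding weak_solution_def by (fastforce simp: bump_eq_0)
  \<comment> \<open>For \<open>t > 0\<close>, \<open>t\<close> times the inner integral is
    \<open>?a * bump (t - 2) + ?b * t * bump' (t - 2)\<close>. Adding and subtracting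
    \<open>?b * bump (t - 2)\<close> exposes \<open>X\<close>, whose contribution integrates to
    0.\<close>
  also have "\<dots> = (LINT t|lborel. (?a - ?b) * bump (t - 2) + ?b * X t)"
  proof (rule Bochner_Integration.integral_cong[OF refl])
    fix t :: real
    show "indicator {0<..} t * (t * (LINT \<xi>|lborel. w \<xi> * \<phi>t (\<xi> * t) t + f \<xi> * \<phi>x (\<xi> * t) t))
        = (?a - ?b) * bump (t - 2) + ?b * X t"
    proof (cases "0 < t")
      case True
      have "(\<lambda>\<xi>. w \<xi> * \<phi>t (\<xi> * t) t + f \<xi> * \<phi>x (\<xi> * t) t)
          = (\<lambda>\<xi>. bump (t - 2) / t * ((f \<xi> - \<xi> * w \<xi>) * \<theta> \<xi>) + bump' (t - 2) * (w \<xi> * \<Theta> \<xi>))"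
        using True by (auto simp: \<phi>t_def \<phi>x_def field_simps power2_eq_square)
      then have "(LINT \<xi>|lborel. w \<xi> * \<phi>t (\<xi> * t) t + f \<xi> * \<phi>x (\<xi> * t) t)
          = bump (t - 2) / t * ?a + bump' (t - 2) * ?b"
        using int int' by simp
      then show ?thesis
        using True by (simp add: X_def algebra_simps)
    next
      case False
      then show ?thesis
        by (simp add: X_def bump_eq_0)
    qed
  qed
  also have "\<dots> = (?a - ?b) * (16 / 15)"
    using X integral_bump_shift(1)[of 2]
    by (simp add: has_bochner_integral_iff integral_bump_shift(2))
  finally show ?thesis by simp
qed

subsection \<open>Locally Lipschitz versions of weak primitives\<close>

text \<open>Links the measure-theoretic quantifier with the negligible sets of gauge integration.
  The exceptional set need not be Borel, hence the detour through the completion.\<close>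

lemma AE_lborel_iff_negligible:
  fixes P :: "'a::euclidean_space \<Rightarrow> bool"
  shows "(AE x in lborel. P x) \<longleftrightarrow> negligible {x. \<not> P x}"
proof
  assume "AE x in lborel. P x"
  then have "AE x in lebesgue. P x"
    by (rule AE_completion)
  then obtain N where "N \<in> null_sets lebesgue" "{x. \<not> P x} \<subseteq> N"
    by (auto simp: eventually_ae_filter)
  then show "negligible {x. \<not> P x}"
    using negligible_subset by (auto simp: negligible_iff_null_sets)
next
  assume "negligible {x. \<not> P x}"
  then have "AE x in lebesgue. P x"
    by (intro AE_I') (auto simp: negligible_iff_null_sets)
  then show "AE x in lborel. P x"
    by (simp add: AE_completion_iff)
qed

text \<open>Half-open intervals occur because differences of shifted copies of
  \<open>indicator {0<..}\<close> are indicators of such intervals.\<close>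

lemma lborel_integral_Ioc:
  fixes g :: "real \<Rightarrow> real"
  assumes [measurable]: "g \<in> borel_measurable borel" and g: "\<And>x. a \<le> x \<Longrightarrow> x \<le> b \<Longrightarrow> \<bar>g x\<bar> \<le> C"
  shows "g integrable_on {a..b}" "integrable lborel (\<lambda>x. g x * indicator {a<..b} x)"
    "(LINT x|lborel. g x * indicator {a<..b} x) = integral {a..b} g"
proof -
  have int: "integrable lborel (\<lambda>x. g x * indicator S x)" if "S \<subseteq> {a..b}" "S \<in> sets borel" for S
  proof (rule integrableI_bounded_set[where A = "{a..b}" and B = C])
    show "AE x in lborel. x \<in> {a..b} \<longrightarrow> norm (g x * indicator S x) \<le> C"
    proof (intro always_eventually allI impI)
      fix x assume x: "x \<in> {a..b}"
      then show "norm (g x * indicator S x) \<le> C"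
        using g[of x] by (auto simp: indicator_def)
    qed
    show "AE x in lborel. x \<notin> {a..b} \<longrightarrow> g x * indicator S x = 0"
      using that(1) by (intro always_eventually) (auto simp: indicator_def)
  qed (use that(2) in \<open>auto simp: emeasure_lborel_Icc_eq\<close>)
  then have "set_integrable lborel {a..b} g"
    by (simp add: set_integrable_def mult.commute)
  from set_borel_integral_eq_integral[OF this]
  have *: "g integrable_on {a..b}" "(LINT x|lborel. g x * indicator {a..b} x) = integral {a..b} g"
    by (simp_all add: set_lebesgue_integral_def mult.commute)
  have "(LINT x|lborel. g x * indicator {a<..b} x) = (LINT x|lborel. g x * indicator {a..b} x)"
  proof (rule integral_cong_AE)
    show "AE x in lborel. g x * indicator {a<..b} x = g x * indicator {a..b} x"
      using AE_lborel_singleton[of a] by eventually_elim (auto simp: indicator_def)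
  qed auto
  with * show "g integrable_on {a..b}" "(LINT x|lborel. g x * indicator {a<..b} x) = integral {a..b} g"
    by auto
  show "integrable lborel (\<lambda>x. g x * indicator {a<..b} x)"
    by (rule int) auto
qed

lemma integrable_const_indicator_Icc: "integrable lborel (\<lambda>x::real. c * indicator {a..b} x :: real)"
  by (auto intro!: integrable_mult_right integrable_real_indicator simp: emeasure_lborel_Icc_eq)

lemma integral_LIMSEQ_bounded:
  fixes s :: "nat \<Rightarrow> real \<Rightarrow> real"
  assumes "g \<in> borel_measurable borel" "\<And>i. s i \<in> borel_measurable borel"
    and "\<And>x. (\<lambda>i. s i x) \<longlonglongrightarrow> g x"
    and "\<And>i x. \<bar>s i x\<bar> \<le> K * indicator {a..b} x"
  shows "(\<lambda>i. LINT x|lborel. s i x) \<longlonglongrightarrow> (LINT x|lborel. g x)"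
  using assms
  by (intro integral_dominated_convergence[where w = "\<lambda>x. K * indicator {a..b} x"]
      integrable_const_indicator_Icc) auto

text \<open>
  Applied to \<open>F = max 0\<close> this is the trapezoid that rises from 0 to 1 on \<open>[a, a + h]\<close> and falls back on
  \<open>[b, b + h]\<close>; its derivative is obtained from \<open>F = indicator {0<..}\<close>.
\<close>

definition trapezoid_comb :: "real \<Rightarrow> real \<Rightarrow> real \<Rightarrow> (real \<Rightarrow> real) \<Rightarrow> real \<Rightarrow> real" where
  "trapezoid_comb a b h F x = (F (x - a) - F (x - a - h) - F (x - b) + F (x - b - h)) / h"

text \<open>The weak identity is available for C^1 functions only, and the trapezoid has corners.
  Its ramps are smoothed at scale \<open>\<epsilon> k\<close>, and dominated convergence carries the
  identity to the limit.\<close>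

lemma weak_primitive_trapezoid:
  fixes m w :: "real \<Rightarrow> real"
  assumes [measurable]: "m \<in> borel_measurable borel" "w \<in> borel_measurable borel"
    and w: "\<And>x. \<bar>w x\<bar> \<le> C" and m: "\<And>x. \<bar>m x\<bar> \<le> C * (1 + \<bar>x\<bar>)"
    and weak: "\<And>\<Theta> \<theta> R. (\<And>x. (\<Theta> has_real_derivative \<theta> x) (at x)) \<Longrightarrow> continuous_on UNIV \<theta> \<Longrightarrow>
      (\<And>x. R < \<bar>x\<bar> \<Longrightarrow> \<Theta> x = 0 \<and> \<theta> x = 0) \<Longrightarrow>
      (LINT x|lborel. m x * \<theta> x) = (LINT x|lborel. w x * \<Theta> x)"
    and h: "0 < h" and ab: "a < b"
  shows "(LINT x|lborel. m x * trapezoid_comb a b h (indicator {0<..}) x)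
    = (LINT x|lborel. w x * trapezoid_comb a b h (max 0) x)"
proof -
  \<comment> \<open>\<open>S \<epsilon>\<close> is a \<open>C\<^sup>1\<close> approximation of \<open>max 0\<close>, with derivative \<open>D \<epsilon>\<close>.\<close>
  define S :: "real \<Rightarrow> real \<Rightarrow> real" where "S \<epsilon> y = ((max 0 y)\<^sup>2 - (max 0 (y - \<epsilon>))\<^sup>2) / (2 * \<epsilon>)" for \<epsilon> y
  define D :: "real \<Rightarrow> real \<Rightarrow> real" where "D \<epsilon> y = (max 0 y - max 0 (y - \<epsilon>)) / \<epsilon>" for \<epsilon> y
  define \<epsilon> :: "nat \<Rightarrow> real" where "\<epsilon> k = 1 / real (Suc k)" for k
  have \<epsilon>: "0 < \<epsilon> k" "\<epsilon> k \<le> 1" for k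
    by (auto simp: \<epsilon>_def divide_le_eq)
  have \<epsilon>0: "\<epsilon> \<longlonglongrightarrow> 0"
    unfolding \<epsilon>_def using LIMSEQ_inverse_real_of_nat by (simp add: inverse_eq_divide)
  have S_neg: "S e y = 0" "D e y = 0" if "y \<le> 0" "0 < e" for e y
    using that by (auto simp: S_def D_def)
  have S_pos: "S e y = y - e / 2" "D e y = 1" if "e \<le> y" "0 < e" for e y
    using that by (auto simp: S_def D_def power2_eq_square field_simps)
  have D01: "0 \<le> D e y" "D e y \<le> 1" if "0 < e" for e y
    using that by (auto simp: D_def field_simps max_def)
  have S01: "0 \<le> S e y" "S e y \<le> max 0 y" if "0 < e" for e y
  proof -
    consider "y \<le> 0" | "0 < y" "y < e" | "e \<le> y"
      by linarith
    then have "0 \<le> S e y \<and> S e y \<le> max 0 y"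
    proof cases
      case 2
      then have "y * y \<le> y * (2 * e)"
        by (intro mult_left_mono) auto
      then show ?thesis using 2 by (auto simp: S_def power2_eq_square field_simps)
    qed (use that in \<open>auto simp: S_neg S_pos\<close>)
    then show "0 \<le> S e y" "S e y \<le> max 0 y" by auto
  qed
  have dS: "(S e has_real_derivative D e y) (at y)" if "0 < e" for e y
  proof -
    have "((\<lambda>y. y - e) has_real_derivative 1) (at y)"
      by (auto intro!: derivative_eq_intros)
    from DERIV_chain2[OF DERIV_pos_part_square this]
    have "((\<lambda>y. (max 0 (y - e))\<^sup>2) has_real_derivative 2 * max 0 (y - e)) (at y)"
      by simp
    from DERIV_cdivide[OF DERIV_diff[OF DERIV_pos_part_square this], of "2 * e"] show ?thesis
      using that by (simp add: S_def[abs_def] D_def diff_divide_distrib)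
  qed
  let ?T = "trapezoid_comb a b h"
  have contD: "continuous_on UNIV (?T (D e))" if "0 < e" for e
    unfolding trapezoid_comb_def D_def using h that by (intro continuous_intros) auto
  have dT: "(?T (S e) has_real_derivative ?T (D e) x) (at x)" if "0 < e" for e x
  proof -
    have shift: "((\<lambda>x. S e (x - c)) has_real_derivative D e (x - c)) (at x)" for c
    proof -
      have "((\<lambda>y. y - c) has_real_derivative 1) (at x)"
        by (auto intro!: derivative_eq_intros)
      from DERIV_chain2[OF dS[OF that] this] show ?thesis by simp
    qed
    show ?thesis
      unfolding trapezoid_comb_def[abs_def] diff_diff_eq
      by (intro DERIV_cdivide DERIV_add DERIV_diff shift)
  qed
  have supp_neg: "?T F x = 0" if "x \<le> a" "\<And>y. y \<le> 0 \<Longrightarrow> F y = 0" for F x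
    using that h ab by (simp add: trapezoid_comb_def)
  \<comment> \<open>Here all four shifted arguments exceed \<open>e\<close>, where
    \<open>S e\<close> is affine and \<open>D e\<close> is constant, so the four terms cancel. Since
    \<open>e \<le> 1\<close>, the threshold is independent of \<open>e\<close>.\<close>
  have supp_pos: "?T (S e) x = 0" "?T (D e) x = 0" if "b + h + 1 \<le> x" "0 < e" "e \<le> 1" for e x
    using that h ab by (simp_all add: trapezoid_comb_def S_pos)
  \<comment> \<open>The largest argument, \<open>x - a\<close>, that occurs for
    \<open>x \<le> b + h + 1\<close>; it bounds the smoothed ramps there.\<close>
  define L where "L = b + h + 1 - a"
  have boundT: "\<bar>?T F x\<bar> \<le> 4 * K / h" if "\<And>y. y \<le> L \<Longrightarrow> 0 \<le> F y \<and> F y \<le> K" "x \<le> b + h + 1" for F x K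
  proof -
    have F: "0 \<le> F y \<and> F y \<le> K" if "y \<in> {x - a, x - a - h, x - b, x - b - h}" for y
      using \<open>\<And>y. y \<le> L \<Longrightarrow> 0 \<le> F y \<and> F y \<le> K\<close>[of y] that \<open>x \<le> b + h + 1\<close> h ab by (auto simp: L_def)
    have "\<bar>F (x - a) - F (x - a - h) - F (x - b) + F (x - b - h)\<bar> \<le> 4 * K"
      using F[of "x - a"] F[of "x - a - h"] F[of "x - b"] F[of "x - b - h"] by (simp add: abs_le_iff)
    then show ?thesis
      unfolding trapezoid_comb_def abs_divide using h by (simp add: divide_right_mono)
  qed
  have L: "0 < L"
    using h ab by (simp add: L_def)
  have bound: "\<bar>?T F x\<bar> \<le> 4 * K / h * indicator {a..b + h + 1} x"
    if "\<And>y. y \<le> 0 \<Longrightarrow> F y = 0" "\<And>y. y \<le> L \<Longrightarrow> 0 \<le> F y \<and> F y \<le> K"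
      "\<And>x. b + h + 1 \<le> x \<Longrightarrow> ?T F x = 0" for F x K
  proof -
    consider "x < a" | "x \<in> {a..b + h + 1}" | "b + h + 1 < x"
      by fastforce
    then show ?thesis
    proof cases
      case 1
      then show ?thesis using supp_neg[of x F] that(1) by simp
    next
      case 2
      then show ?thesis using boundT[of F K x] that(2) by simp
    next
      case 3
      then show ?thesis using that(3)[of x] by simp
    qed
  qed
  have bound_S: "\<bar>?T (S (\<epsilon> k)) x\<bar> \<le> 4 * L / h * indicator {a..b + h + 1} x" for k x
  proof (rule bound)
    show "0 \<le> S (\<epsilon> k) y \<and> S (\<epsilon> k) y \<le> L" if "y \<le> L" for y
      using S01[OF \<epsilon>(1), of k y] that L by auto
  qed (use \<epsilon> S_neg supp_pos in auto)
  have bound_D: "\<bar>?T (D (\<epsilon> k)) x\<bar> \<le> 4 * 1 / h * indicator {a..b + h + 1} x" for k x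
    by (rule bound) (use \<epsilon> S_neg supp_pos D01 in auto)
  have limD: "(\<lambda>k. D (\<epsilon> k) y) \<longlonglongrightarrow> indicator {0<..} y" for y
  proof (cases "0 < y")
    case True
    then have "\<forall>\<^sub>F k in sequentially. \<epsilon> k < y"
      using order_tendstoD(2)[OF \<epsilon>0] by blast
    then have "\<forall>\<^sub>F k in sequentially. D (\<epsilon> k) y = 1"
      by eventually_elim (use \<epsilon> in \<open>auto simp: S_pos\<close>)
    then show ?thesis using True by (auto intro: tendsto_eventually)
  qed (use \<epsilon> in \<open>simp add: S_neg\<close>)
  have limS: "(\<lambda>k. S (\<epsilon> k) y) \<longlonglongrightarrow> max 0 y" for y
  proof (cases "0 < y")
    case True
    then have "\<forall>\<^sub>F k in sequentially. \<epsilon> k < y"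
      using order_tendstoD(2)[OF \<epsilon>0] by blast
    then have "\<forall>\<^sub>F k in sequentially. y - \<epsilon> k / 2 = S (\<epsilon> k) y"
      by eventually_elim (use \<epsilon> in \<open>auto simp: S_pos\<close>)
    moreover have "(\<lambda>k. y - \<epsilon> k / 2) \<longlonglongrightarrow> y - 0 / 2"
      by (intro tendsto_intros \<epsilon>0) simp
    ultimately show ?thesis using True by (auto intro: Lim_transform_eventually)
  qed (use \<epsilon> in \<open>simp add: S_neg\<close>)
  have limT: "(\<lambda>k. ?T (F k) x) \<longlonglongrightarrow> ?T G x" if "\<And>y. (\<lambda>k. F k y) \<longlonglongrightarrow> G y" for F G x
    unfolding trapezoid_comb_def using h by (intro tendsto_intros that) auto
  have meas: "?T F \<in> borel_measurable borel" if [measurable]: "F \<in> borel_measurable borel" for F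
    unfolding trapezoid_comb_def[abs_def] by measurable
  have [measurable]: "S e \<in> borel_measurable borel" "D e \<in> borel_measurable borel" for e
    unfolding S_def[abs_def] D_def[abs_def] by measurable
  note [measurable] = meas
  have C: "0 \<le> C"
    using w[of 0] by linarith
  have "(\<lambda>k. LINT x|lborel. m x * ?T (D (\<epsilon> k)) x) \<longlonglongrightarrow> (LINT x|lborel. m x * ?T (indicator {0<..}) x)"
  proof (rule integral_LIMSEQ_bounded)
    show "\<bar>m x * ?T (D (\<epsilon> k)) x\<bar>
        \<le> C * (1 + (\<bar>a\<bar> + \<bar>b + h + 1\<bar>)) * (4 * 1 / h) * indicator {a..b + h + 1} x" for k x
    proof (cases "x \<in> {a..b + h + 1}")
      case True
      then have "\<bar>m x\<bar> \<le> C * (1 + (\<bar>a\<bar> + \<bar>b + h + 1\<bar>))"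
        by (intro order_trans[OF m] mult_left_mono C) auto
      then show ?thesis
        unfolding abs_mult mult.assoc[of _ _ "indicator _ _"] using bound_D by (intro mult_mono') auto
    next
      case False
      then show ?thesis using bound_D[of k x] by simp
    qed
    show "(\<lambda>k. m x * ?T (D (\<epsilon> k)) x) \<longlonglongrightarrow> m x * ?T (indicator {0<..}) x" for x
      by (intro tendsto_intros limT limD)
  qed measurable
  moreover have "(\<lambda>k. LINT x|lborel. w x * ?T (S (\<epsilon> k)) x) \<longlonglongrightarrow> (LINT x|lborel. w x * ?T (max 0) x)"
  proof (rule integral_LIMSEQ_bounded)
    show "\<bar>w x * ?T (S (\<epsilon> k)) x\<bar> \<le> C * (4 * L / h) * indicator {a..b + h + 1} x" for k x
      unfolding abs_mult mult.assoc using bound_S w by (intro mult_mono') auto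
    show "(\<lambda>k. w x * ?T (S (\<epsilon> k)) x) \<longlonglongrightarrow> w x * ?T (max 0) x" for x
      by (intro tendsto_intros limT limS)
  qed measurable
  moreover have "(LINT x|lborel. m x * ?T (D (\<epsilon> k)) x) = (LINT x|lborel. w x * ?T (S (\<epsilon> k)) x)" for k
  proof (rule weak[OF dT[OF \<epsilon>(1)] contD[OF \<epsilon>(1)], where R = "\<bar>a\<bar> + \<bar>b + h + 1\<bar>"])
    show "?T (S (\<epsilon> k)) x = 0 \<and> ?T (D (\<epsilon> k)) x = 0" if "\<bar>a\<bar> + \<bar>b + h + 1\<bar> < \<bar>x\<bar>" for x
    proof -
      have "x \<notin> {a..b + h + 1}"
        using that by auto
      then show ?thesis
        using bound_S[of k x] bound_D[of k x] by simp
    qed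
  qed
  ultimately show ?thesis
    using LIMSEQ_unique by auto
qed

text \<open>As the ramps of the trapezoid shrink, one side becomes the difference of averages of
  \<open>m\<close> just to the right of \<open>a\<close> and \<open>b\<close>, which converge at
  Lebesgue points; the other becomes the integral of \<open>w\<close> between them.\<close>

lemma weak_primitive_Lebesgue_points:
  fixes m w :: "real \<Rightarrow> real"
  assumes meas [measurable]: "m \<in> borel_measurable borel" "w \<in> borel_measurable borel"
    and w: "\<And>x. \<bar>w x\<bar> \<le> C" and m: "\<And>x. \<bar>m x\<bar> \<le> C * (1 + \<bar>x\<bar>)"
    and weak: "\<And>\<Theta> \<theta> R. (\<And>x. (\<Theta> has_real_derivative \<theta> x) (at x)) \<Longrightarrow> continuous_on UNIV \<theta> \<Longrightarrow>
      (\<And>x. R < \<bar>x\<bar> \<Longrightarrow> \<Theta> x = 0 \<and> \<theta> x = 0) \<Longrightarrow>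
      (LINT x|lborel. m x * \<theta> x) = (LINT x|lborel. w x * \<Theta> x)"
  obtains N where "negligible N"
    "\<And>a b. a \<notin> N \<Longrightarrow> b \<notin> N \<Longrightarrow> a < b \<Longrightarrow> m a - m b = integral {a..b} w"
proof -
  have C: "0 \<le> C"
    using w[of 0] by linarith
  have m_bdd: "\<bar>m x\<bar> \<le> C * (1 + (\<bar>a\<bar> + \<bar>b\<bar>))" if "a \<le> x" "x \<le> b" for a b x
    using that by (intro order_trans[OF m] mult_left_mono C) auto
  have m_Ioc: "m integrable_on {a..b}" "integrable lborel (\<lambda>x. m x * indicator {a<..b} x)"
      "(LINT x|lborel. m x * indicator {a<..b} x) = integral {a..b} m" for a b
    using m_bdd[of a _ b] by (auto intro!: lborel_integral_Ioc)
  note w_Ioc = lborel_integral_Ioc[OF meas(2) w]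
  \<comment> \<open>The Lebesgue differentiation theorem with one-sided intervals.\<close>
  obtain N where N: "negligible N"
    "\<And>x e. x \<notin> N \<Longrightarrow> 0 < e \<Longrightarrow> \<exists>d>0. \<forall>h. 0 < h \<and> h < d \<longrightarrow>
      norm (integral (cbox x (x + h *\<^sub>R One)) m /\<^sub>R h ^ DIM(real) - m x) < e"
    by (rule integrable_ccontinuous_explicit[of m]) (use m_Ioc(1) in auto)
  define \<epsilon> :: "nat \<Rightarrow> real" where "\<epsilon> k = 1 / real (Suc k)" for k
  have \<epsilon>: "0 < \<epsilon> k" "\<epsilon> k \<le> 1" for k
    by (auto simp: \<epsilon>_def divide_le_eq)
  have \<epsilon>0: "\<epsilon> \<longlonglongrightarrow> 0"
    unfolding \<epsilon>_def using LIMSEQ_inverse_real_of_nat by (simp add: inverse_eq_divide)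
  have average: "(\<lambda>k. integral {a..a + \<epsilon> k} m / \<epsilon> k) \<longlonglongrightarrow> m a" if "a \<notin> N" for a
  proof (rule tendstoI)
    fix e :: real
    assume "0 < e"
    from N(2)[OF that this] obtain d where "0 < d"
      "\<And>h. 0 < h \<Longrightarrow> h < d \<Longrightarrow> \<bar>integral {a..a + h} m / h - m a\<bar> < e"
      by (auto simp: divide_inverse mult.commute)
    with order_tendstoD(2)[OF \<epsilon>0, of d] \<epsilon>(1)
    show "\<forall>\<^sub>F k in sequentially. dist (integral {a..a + \<epsilon> k} m / \<epsilon> k) (m a) < e"
      by (auto simp: dist_real_def elim: eventually_mono)
  qed
  have "m a - m b = integral {a..b} w" if "a \<notin> N" "b \<notin> N" "a < b" for a b
  proof -
    let ?T = "\<lambda>k. trapezoid_comb a b (\<epsilon> k)"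
    have "(\<lambda>k. integral {a..a + \<epsilon> k} m / \<epsilon> k - integral {b..b + \<epsilon> k} m / \<epsilon> k) \<longlonglongrightarrow> m a - m b"
      using that by (intro tendsto_diff average)
    moreover have "integral {a..a + \<epsilon> k} m / \<epsilon> k - integral {b..b + \<epsilon> k} m / \<epsilon> k
        = (LINT x|lborel. w x * ?T k (max 0) x)" for k
    proof -
      have "(\<lambda>x. m x * ?T k (indicator {0<..}) x) =
          (\<lambda>x. m x * indicator {a<..a + \<epsilon> k} x / \<epsilon> k - m x * indicator {b<..b + \<epsilon> k} x / \<epsilon> k)"
        using \<epsilon>[of k] by (auto simp: trapezoid_comb_def indicator_def field_simps)
      then have "integral {a..a + \<epsilon> k} m / \<epsilon> k - integral {b..b + \<epsilon> k} m / \<epsilon> k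
          = (LINT x|lborel. m x * ?T k (indicator {0<..}) x)"
        using m_Ioc by simp
      also have "\<dots> = (LINT x|lborel. w x * ?T k (max 0) x)"
        by (rule weak_primitive_trapezoid[OF meas w m _ \<epsilon>(1) \<open>a < b\<close>]) (rule weak)
      finally show ?thesis .
    qed
    moreover have "(\<lambda>k. LINT x|lborel. w x * ?T k (max 0) x) \<longlonglongrightarrow> (LINT x|lborel. w x * indicator {a<..b} x)"
    proof (rule integral_LIMSEQ_bounded)
      define r :: "real \<Rightarrow> real \<Rightarrow> real" where "r e y = (max 0 y - max 0 (y - e)) / e" for e y
      \<comment> \<open>A difference of two ramps with values in \<open>[0, 1]\<close>: its modulus
        is at most 1, and each ramp tends to a jump.\<close>
      have T: "?T k (max 0) x = r (\<epsilon> k) (x - a) - r (\<epsilon> k) (x - b)" for k x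
        by (simp add: trapezoid_comb_def r_def diff_divide_distrib add_divide_distrib)
      have r01: "0 \<le> r e y" "r e y \<le> 1" if "0 < e" for e y
        using that by (auto simp: r_def field_simps max_def)
      have r_neg: "r e y = 0" if "y \<le> 0" "0 < e" for e y
        using that by (auto simp: r_def)
      have r_pos: "r e y = 1" if "e \<le> y" "0 < e" for e y
        using that by (auto simp: r_def)
      show "\<bar>w x * ?T k (max 0) x\<bar> \<le> C * indicator {a..b + 1} x" for k x
      proof (cases "x \<in> {a..b + 1}")
        case True
        have "\<bar>?T k (max 0) x\<bar> \<le> 1"
          using r01[OF \<epsilon>(1), of k "x - a"] r01[OF \<epsilon>(1), of k "x - b"] unfolding T by linarith
        then have "\<bar>w x\<bar> * \<bar>?T k (max 0) x\<bar> \<le> C * 1"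
          using w by (intro mult_mono') auto
        then show ?thesis using True by (simp add: abs_mult)
      next
        case False
        then have "?T k (max 0) x = 0"
          using \<epsilon>[of k] \<open>a < b\<close> unfolding T by (cases "x < a") (auto simp: r_neg r_pos)
        then show ?thesis using C by simp
      qed
      have lim_r: "(\<lambda>k. r (\<epsilon> k) y) \<longlonglongrightarrow> indicator {0<..} y" for y
      proof (cases "0 < y")
        case True
        then have "\<forall>\<^sub>F k in sequentially. \<epsilon> k < y"
          using order_tendstoD(2)[OF \<epsilon>0] by blast
        then have "\<forall>\<^sub>F k in sequentially. r (\<epsilon> k) y = 1"
          by eventually_elim (use \<epsilon> in \<open>auto simp: r_pos\<close>)
        then show ?thesis using True by (auto intro: tendsto_eventually)
      qed (use \<epsilon> in \<open>simp add: r_neg\<close>)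
      have ind: "indicator {a<..b} x = (indicator {0<..} (x - a) - indicator {0<..} (x - b) :: real)" for x
        using \<open>a < b\<close> by (auto simp: indicator_def)
      show "(\<lambda>k. w x * ?T k (max 0) x) \<longlonglongrightarrow> w x * indicator {a<..b} x" for x
        unfolding T ind by (intro tendsto_intros lim_r)
    qed (unfold trapezoid_comb_def[abs_def], measurable)
    ultimately show ?thesis
      using LIMSEQ_unique w_Ioc(3) by auto
  qed
  with N(1) show ?thesis by (rule that)
qed

text \<open>Anchoring at one point \<open>c\<close> outside the exceptional set turns the increment
  formula into a definition valid everywhere: \<open>M x\<close> is \<open>m c\<close> plus the
  oriented integral of \<open>w\<close> from \<open>x\<close> to \<open>c\<close>.\<close>

lemma weak_primitive:
  fixes m w :: "real \<Rightarrow> real"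
  assumes meas: "m \<in> borel_measurable borel" "w \<in> borel_measurable borel"
    and w: "\<And>x. \<bar>w x\<bar> \<le> C" and m: "\<And>x. \<bar>m x\<bar> \<le> C * (1 + \<bar>x\<bar>)"
    and weak: "\<And>\<Theta> \<theta> R. (\<And>x. (\<Theta> has_real_derivative \<theta> x) (at x)) \<Longrightarrow> continuous_on UNIV \<theta> \<Longrightarrow>
      (\<And>x. R < \<bar>x\<bar> \<Longrightarrow> \<Theta> x = 0 \<and> \<theta> x = 0) \<Longrightarrow>
      (LINT x|lborel. m x * \<theta> x) = (LINT x|lborel. w x * \<Theta> x)"
  obtains M where "AE x in lborel. m x = M x" "\<And>a b. a \<le> b \<Longrightarrow> M a - M b = integral {a..b} w"
proof -
  obtain N where N: "negligible N"
    "\<And>a b. a \<notin> N \<Longrightarrow> b \<notin> N \<Longrightarrow> a < b \<Longrightarrow> m a - m b = integral {a..b} w"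
    by (rule weak_primitive_Lebesgue_points[OF meas w m weak]) blast+
  have "N \<noteq> UNIV"
    using N(1) non_negligible_UNIV by metis
  then obtain c where c: "c \<notin> N" by blast
  have int: "w integrable_on {a..b}" for a b
    by (rule lborel_integral_Ioc(1)[OF meas(2) w])
  have split: "integral {x..y} w + integral {y..z} w = integral {x..z} w" if "x \<le> y" "y \<le> z" for x y z
    using that int by (rule Henstock_Kurzweil_Integration.integral_combine)
  define M where "M x = m c + (if x \<le> c then integral {x..c} w else - integral {c..x} w)" for x
  show ?thesis
  proof (rule that)
    have "m x = M x" if "x \<notin> N" for x
      using N(2)[of x c] N(2)[of c x] that c by (cases x c rule: linorder_cases) (auto simp: M_def)
    then show "AE x in lborel. m x = M x"
      unfolding AE_lborel_iff_negligible by (intro negligible_subset[OF N(1)]) auto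
    show "M a - M b = integral {a..b} w" if "a \<le> b" for a b
      using split[of a b c] split[of a c b] split[of c a b] that by (auto simp: M_def)
  qed
qed

subsection \<open>Uniqueness for the transport equations\<close>

text \<open>The set where the inequality fails is open, and a nonempty open set is not
  negligible.\<close>

lemma AE_le_imp_le_on_open:
  fixes f g :: "real \<Rightarrow> real"
  assumes "open S" "continuous_on S f" "continuous_on S g"
    and AE: "AE x in lborel. x \<in> S \<longrightarrow> f x \<le> g x" and "x \<in> S"
  shows "f x \<le> g x"
proof (rule ccontr)
  assume "\<not> f x \<le> g x"
  define U where "U = S \<inter> (\<lambda>x. f x - g x) -` {0<..}"
  have "open U"
    unfolding U_def using assms by (intro continuous_open_preimage continuous_on_diff) auto
  moreover have "U \<noteq> {}"
    using \<open>x \<in> S\<close> \<open>\<not> f x \<le> g x\<close> by (auto simp: U_def)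
  moreover have "negligible U"
    using AE unfolding AE_lborel_iff_negligible by (rule negligible_subset) (auto simp: U_def)
  ultimately show False
    using open_not_negligible by blast
qed

lemma AE_lborel_obtain_in_open:
  fixes S :: "real set"
  assumes AE: "AE x in lborel. P x" and "open S" "S \<noteq> {}"
  obtains x where "x \<in> S" "P x"
proof -
  have "\<not> negligible S"
    using assms by (intro open_not_negligible)
  then have "\<not> S \<subseteq> {x. \<not> P x}"
    using AE negligible_subset unfolding AE_lborel_iff_negligible by blast
  then show ?thesis using that by blast
qed

text \<open>The fundamental theorem on a small interval around \<open>x\<close>; the minus sign
  comes from writing increments as \<open>F a - F b\<close>.\<close>

lemma DERIV_of_integral_increments:
  fixes F g :: "real \<Rightarrow> real"
  assumes "open S" "x \<in> S" and cont: "continuous_on S g"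
    and F: "\<And>a b. a \<le> b \<Longrightarrow> {a..b} \<subseteq> S \<Longrightarrow> F a - F b = integral {a..b} g"
  shows "(F has_real_derivative - g x) (at x)"
proof -
  obtain e where e: "0 < e" "cball x e \<subseteq> S"
    using assms open_contains_cball by blast
  then have sub: "{x - e..x + e} \<subseteq> S"
    by (simp add: cball_eq_atLeastAtMost)
  have "((\<lambda>y. integral {x - e..y} g) has_real_derivative g x) (at x within {x - e..x + e})"
    by (rule integral_has_real_derivative) (use e sub cont continuous_on_subset in auto)
  then have "((\<lambda>y. integral {x - e..y} g) has_real_derivative g x) (at x)"
    using e by (simp add: at_within_Icc_at)
  from DERIV_diff[OF DERIV_const[of "F (x - e)"] this]
  have "((\<lambda>y. F (x - e) - integral {x - e..y} g) has_real_derivative - g x) (at x)"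
    by simp
  then show ?thesis
  proof (rule has_field_derivative_transform_within_open[where S = "{x - e<..<x + e}"])
    show "F (x - e) - integral {x - e..y} g = F y" if "y \<in> {x - e<..<x + e}" for y
    proof -
      have "{x - e..y} \<subseteq> {x - e..x + e}"
        using that by auto
      then have "{x - e..y} \<subseteq> S"
        using sub by blast
      then show ?thesis
        using F[of "x - e" y] that by auto
    qed
  qed (use e in auto)
qed

lemma continuous_on_of_integral_increments:
  fixes F g :: "real \<Rightarrow> real"
  assumes int: "\<And>a b. g integrable_on {a..b}"
    and F: "\<And>a b. a \<le> b \<Longrightarrow> F a - F b = integral {a..b} g"
  shows "continuous_on UNIV F"
proof -
  have "isCont F x" for x
  proof -
    have "continuous_on {x - 1..x + 1} (\<lambda>y. F (x - 1) - integral {x - 1..y} g)"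
      by (intro continuous_intros indefinite_integral_continuous_1 int)
    then have "continuous_on {x - 1..x + 1} F"
      by (rule continuous_on_eq) (use F[of "x - 1"] in \<open>auto simp: algebra_simps\<close>)
    then show ?thesis
      by (rule continuous_on_interior) auto
  qed
  then show ?thesis
    by (simp add: continuous_on_eq_continuous_at)
qed

section \<open>Structure of self-similar transport solutions\<close>

text \<open>On \<open>S\<close> the velocity agrees almost everywhere with the continuous quotient
  \<open>U = Q / M\<close>, and the density with \<open>R = M / (U - x)\<close>. With these versions
  \<open>M\<close> and \<open>Q\<close> have classical derivatives, so quotients can be
  differentiated pointwise.\<close>

lemma self_similar_constant_state:
  fixes \<rho> u M Q :: "real \<Rightarrow> real"
  assumes S: "open S" "convex S"
    and \<rho>: "\<And>x. \<bar>\<rho> x\<bar> \<le> C"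
    and M: "\<And>a b. a \<le> b \<Longrightarrow> M a - M b = integral {a..b} \<rho>" "continuous_on UNIV M"
    and Q: "\<And>a b. a \<le> b \<Longrightarrow> Q a - Q b = integral {a..b} (\<lambda>x. \<rho> x * u x)" "continuous_on UNIV Q"
    and AE: "AE x in lborel. \<rho> x * u x - x * \<rho> x = M x"
      "AE x in lborel. \<rho> x * (u x)\<^sup>2 - x * (\<rho> x * u x) = Q x"
    and nz: "\<And>x. x \<in> S \<Longrightarrow> M x \<noteq> 0"
  obtains c K where "c \<notin> S" "\<And>x. x \<in> S \<Longrightarrow> M x = K * (c - x)"
    "AE x in lborel. x \<in> S \<longrightarrow> \<rho> x = K \<and> u x = c"
proof -
  define U where "U x = Q x / M x" for x
  have contM: "continuous_on S M" and contQ: "continuous_on S Q"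
    using M(2) Q(2) continuous_on_subset by blast+
  have contU: "continuous_on S U"
    unfolding U_def using contM contQ nz by (intro continuous_intros) auto
  have AE_U: "AE x in lborel. x \<in> S \<longrightarrow> u x = U x \<and> M x = \<rho> x * (U x - x)"
    using AE
  proof eventually_elim
    case (elim x)
    have "M x = \<rho> x * (u x - x)" "Q x = u x * M x"
      unfolding elim[symmetric] by (simp_all add: algebra_simps power2_eq_square)
    then show ?case
      using nz[of x] by (auto simp: U_def)
  qed
  \<comment> \<open>Boundedness of the density keeps \<open>U\<close> off the diagonal: by
    continuity the estimate holds at every point of \<open>S\<close>, and \<open>U x = x\<close>
    would force \<open>M x = 0\<close>.\<close>
  then have AE_bound: "AE x in lborel. x \<in> S \<longrightarrow> \<bar>M x\<bar> \<le> C * \<bar>U x - x\<bar>"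
    by eventually_elim (auto simp: abs_mult intro!: mult_right_mono \<rho>)
  have U_neq: "U x \<noteq> x" if "x \<in> S" for x
  proof
    assume "U x = x"
    moreover have "\<bar>M x\<bar> \<le> C * \<bar>U x - x\<bar>"
      by (rule AE_le_imp_le_on_open[OF S(1) _ _ AE_bound that])
        (use contM contU in \<open>auto intro!: continuous_intros\<close>)
    ultimately show False
      using nz[OF that] by simp
  qed
  define R where "R x = M x / (U x - x)" for x
  have contR: "continuous_on S R"
    unfolding R_def using contM contU U_neq by (intro continuous_intros) auto
  have AE_R: "AE x in lborel. x \<in> S \<longrightarrow> \<rho> x = R x \<and> u x = U x"
    using AE_U by eventually_elim (use U_neq in \<open>auto simp: R_def\<close>)
  let ?N = "{x. \<not> (x \<in> S \<longrightarrow> \<rho> x = R x \<and> u x = U x)}"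
  have N: "negligible ?N"
    using AE_R unfolding AE_lborel_iff_negligible .
  have dM: "(M has_real_derivative - R x) (at x)" if "x \<in> S" for x
  proof (rule DERIV_of_integral_increments[OF S(1) that contR])
    show "M a - M b = integral {a..b} R" if "a \<le> b" "{a..b} \<subseteq> S" for a b
      unfolding M(1)[OF that(1)] by (rule integral_spike[OF N]) (use that in auto)
  qed
  have dQ: "(Q has_real_derivative - (R x * U x)) (at x)" if "x \<in> S" for x
  proof (rule DERIV_of_integral_increments[OF S(1) that])
    show "continuous_on S (\<lambda>x. R x * U x)"
      by (intro continuous_intros contR contU)
    show "Q a - Q b = integral {a..b} (\<lambda>x. R x * U x)" if "a \<le> b" "{a..b} \<subseteq> S" for a b
      unfolding Q(1)[OF that(1)] by (rule integral_spike[OF N]) (use that in auto)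
  qed
  have "(U has_real_derivative 0) (at x within S)" if "x \<in> S" for x
  proof -
    have "Q x = U x * M x"
      using nz[OF that] by (simp add: U_def)
    with DERIV_divide[OF dQ[OF that] dM[OF that] nz[OF that]]
    have "((\<lambda>x. Q x / M x) has_real_derivative 0) (at x)"
      by (simp add: mult_ac)
    then show ?thesis
      unfolding U_def[abs_def] by (rule DERIV_subset) simp
  qed
  from has_field_derivative_zero_constant[OF S(2) this]
  obtain c where c: "\<And>x. x \<in> S \<Longrightarrow> U x = c"
    by blast
  have c_notin: "c \<notin> S"
    using c U_neq by blast
  \<comment> \<open>Since \<open>M' = - R\<close> and \<open>M = R * (c - x)\<close>, the numerator
    \<open>- R * (c - x) + M\<close> in the quotient rule vanishes.\<close>
  have "((\<lambda>x. M x / (c - x)) has_real_derivative 0) (at x within S)" if "x \<in> S" for x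
  proof -
    have neq: "c - x \<noteq> 0" and R: "R x * (c - x) = M x"
      using c_notin that c[OF that] by (auto simp: R_def)
    have "((\<lambda>x. c - x) has_real_derivative - 1) (at x)"
      by (auto intro!: derivative_eq_intros)
    from DERIV_divide[OF dM[OF that] this neq] show ?thesis
      using R by (auto intro: DERIV_subset)
  qed
  from has_field_derivative_zero_constant[OF S(2) this]
  obtain K where K: "\<And>x. x \<in> S \<Longrightarrow> M x / (c - x) = K"
    by blast
  show ?thesis
  proof (rule that[OF c_notin])
    show "M x = K * (c - x)" if "x \<in> S" for x
    proof -
      have "c - x \<noteq> 0"
        using c_notin that by auto
      then show ?thesis
        using K[OF that] by (metis nonzero_eq_divide_eq)
    qed
    show "AE x in lborel. x \<in> S \<longrightarrow> \<rho> x = K \<and> u x = c"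
      using AE_R by eventually_elim (use c K in \<open>auto simp: R_def\<close>)
  qed
qed

lemma transport_riemann_solution_bounds:
  assumes "transport_riemann_solution \<rho>m um \<rho>p up \<rho> u"
  obtains C where "\<And>x. \<bar>\<rho> x\<bar> \<le> C" "\<And>x. \<bar>u x\<bar> \<le> C" "\<And>x. \<bar>\<rho> x * u x\<bar> \<le> C"
    "\<And>x. \<bar>\<rho> x * (u x)\<^sup>2\<bar> \<le> C"
proof -
  have "bounded (range \<rho>)" "bounded (range u)"
    using assms unfolding transport_riemann_solution_def by blast+
  then obtain B1 B2 where "\<forall>y \<in> range \<rho>. norm y \<le> B1" "\<forall>y \<in> range u. norm y \<le> B2"
    unfolding bounded_iff by blast
  then have B: "\<bar>\<rho> x\<bar> \<le> B1" "\<bar>u x\<bar> \<le> B2" for x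
    by auto
  have \<rho>u: "\<bar>\<rho> x * u x\<bar> \<le> B1 * B2" and \<rho>uu: "\<bar>\<rho> x * (u x)\<^sup>2\<bar> \<le> B1 * B2\<^sup>2" for x
    unfolding abs_mult power_abs
    by (rule mult_mono'[OF B] mult_mono'[OF B(1) power_mono[OF B(2)]]; simp)+
  have nonneg: "0 \<le> B1" "0 \<le> B2"
    using B[of 0] by linarith+
  then have nonneg': "0 \<le> B1 * B2" "0 \<le> B1 * B2\<^sup>2"
    by auto
  show ?thesis
  proof (rule that)
    fix x
    show "\<bar>\<rho> x\<bar> \<le> B1 + B2 + B1 * B2 + B1 * B2\<^sup>2" "\<bar>u x\<bar> \<le> B1 + B2 + B1 * B2 + B1 * B2\<^sup>2"
      "\<bar>\<rho> x * u x\<bar> \<le> B1 + B2 + B1 * B2 + B1 * B2\<^sup>2"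
      "\<bar>\<rho> x * (u x)\<^sup>2\<bar> \<le> B1 + B2 + B1 * B2 + B1 * B2\<^sup>2"
      using B[of x] \<rho>u[of x] \<rho>uu[of x] nonneg nonneg' by linarith+
  qed
qed

lemma transport_riemann_solution_structure:
  assumes sol: "transport_riemann_solution \<rho>m um \<rho>p up \<rho> u"
  obtains c1 c2 K1 K2 where "c1 \<le> c2" "K1 \<noteq> 0" "K2 \<noteq> 0"
    "AE x in lborel. x < c1 \<longrightarrow> \<rho> x = K1 \<and> u x = c1"
    "AE x in lborel. c1 < x \<and> x < c2 \<longrightarrow> \<rho> x = 0 \<and> u x = x"
    "AE x in lborel. c2 < x \<longrightarrow> \<rho> x = K2 \<and> u x = c2"
proof -
  have meas [measurable]: "\<rho> \<in> borel_measurable borel" "u \<in> borel_measurable borel"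
    and \<rho>_nonneg: "\<And>x. 0 \<le> \<rho> x" and vac: "\<And>x. \<rho> x = 0 \<Longrightarrow> u x = x"
    and weak1: "weak_solution (\<lambda>x t. \<rho> (x / t)) (\<lambda>x t. \<rho> (x / t) * u (x / t)) (\<lambda>x. if x < 0 then \<rho>m else \<rho>p)"
    and weak2: "weak_solution (\<lambda>x t. \<rho> (x / t) * u (x / t)) (\<lambda>x t. \<rho> (x / t) * (u (x / t))\<^sup>2)
      (\<lambda>x. if x < 0 then \<rho>m * um else \<rho>p * up)"
    using sol unfolding transport_riemann_solution_def by blast+
  obtain C where C: "\<And>x. \<bar>\<rho> x\<bar> \<le> C" "\<And>x. \<bar>u x\<bar> \<le> C" "\<And>x. \<bar>\<rho> x * u x\<bar> \<le> C"
      "\<And>x. \<bar>\<rho> x * (u x)\<^sup>2\<bar> \<le> C"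
    by (rule transport_riemann_solution_bounds[OF sol]) blast
  \<comment> \<open>The factor \<open>x\<close> makes \<open>M\<close> grow linearly, which is the
    growth that \<open>weak_primitive\<close> allows.\<close>
  have growth: "\<bar>f - x * w\<bar> \<le> C * (1 + \<bar>x\<bar>)" if "\<bar>w\<bar> \<le> C" "\<bar>f\<bar> \<le> C" for f w x :: real
  proof -
    have "\<bar>x * w\<bar> \<le> \<bar>x\<bar> * C"
      unfolding abs_mult using that by (intro mult_left_mono) auto
    then have "\<bar>f - x * w\<bar> \<le> C + \<bar>x\<bar> * C"
      using that by linarith
    then show ?thesis by (simp add: algebra_simps)
  qed
  obtain M where AE_M: "AE x in lborel. \<rho> x * u x - x * \<rho> x = M x"
    and M: "\<And>a b. a \<le> b \<Longrightarrow> M a - M b = integral {a..b} \<rho>"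
  proof (rule weak_primitive[OF _ meas(1) C(1) growth[OF C(1,3)]])
    show "(LINT x|lborel. (\<rho> x * u x - x * \<rho> x) * \<theta> x) = (LINT x|lborel. \<rho> x * \<Theta> x)"
      if "\<And>x. (\<Theta> has_real_derivative \<theta> x) (at x)" "continuous_on UNIV \<theta>"
        "\<And>x. R < \<bar>x\<bar> \<Longrightarrow> \<Theta> x = 0 \<and> \<theta> x = 0" for \<Theta> \<theta> R
      by (rule weak_solution_self_similar_ode[OF weak1 _ _ C(1,3) that]) auto
  qed auto
  obtain Q where AE_Q: "AE x in lborel. \<rho> x * (u x)\<^sup>2 - x * (\<rho> x * u x) = Q x"
    and Q: "\<And>a b. a \<le> b \<Longrightarrow> Q a - Q b = integral {a..b} (\<lambda>x. \<rho> x * u x)"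
  proof (rule weak_primitive[OF _ _ C(3) growth[OF C(3,4)]])
    show "(LINT x|lborel. (\<rho> x * (u x)\<^sup>2 - x * (\<rho> x * u x)) * \<theta> x) = (LINT x|lborel. \<rho> x * u x * \<Theta> x)"
      if "\<And>x. (\<Theta> has_real_derivative \<theta> x) (at x)" "continuous_on UNIV \<theta>"
        "\<And>x. R < \<bar>x\<bar> \<Longrightarrow> \<Theta> x = 0 \<and> \<theta> x = 0" for \<Theta> \<theta> R
      by (rule weak_solution_self_similar_ode[OF weak2 _ _ C(3,4) that]) auto
  qed auto
  have int_\<rho>: "\<rho> integrable_on {a..b}" and int_\<rho>u: "(\<lambda>x. \<rho> x * u x) integrable_on {a..b}" for a b
    using C by (auto intro!: lborel_integral_Ioc(1))
  have contM: "continuous_on UNIV M"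
    by (rule continuous_on_of_integral_increments[OF int_\<rho> M])
  have contQ: "continuous_on UNIV Q"
    by (rule continuous_on_of_integral_increments[OF int_\<rho>u Q])
  have antimono: "M b \<le> M a" if "a \<le> b" for a b
    using M[OF that] integral_nonneg[OF int_\<rho>, of a b] \<rho>_nonneg by auto
  \<comment> \<open>To the left of \<open>- C\<close> the velocity exceeds \<open>x\<close>. Vacuum
    would mean \<open>u x = x\<close>, so the density is positive there and \<open>M\<close> is
    positive at almost every such point. The choice of \<open>y1\<close> mirrors this.\<close>
  obtain y0 where y0: "y0 < - C" "0 < M y0"
  proof (rule AE_lborel_obtain_in_open[OF AE_M, of "{..<- C}"])
    fix x assume x: "x \<in> {..<- C}" and eq: "\<rho> x * u x - x * \<rho> x = M x"
    then have "0 < u x - x"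
      using C(2)[of x] by (auto simp: abs_le_iff)
    moreover from this have "0 < \<rho> x"
      using vac[of x] \<rho>_nonneg[of x] by (auto simp: less_le)
    ultimately have "0 < \<rho> x * (u x - x)"
      by simp
    then show ?thesis
      using that x eq by (auto simp: algebra_simps)
  qed auto
  obtain y1 where y1: "C < y1" "M y1 < 0"
  proof (rule AE_lborel_obtain_in_open[OF AE_M, of "{C<..}"])
    fix x assume x: "x \<in> {C<..}" and eq: "\<rho> x * u x - x * \<rho> x = M x"
    then have "u x - x < 0"
      using C(2)[of x] by (auto simp: abs_le_iff)
    moreover from this have "0 < \<rho> x"
      using vac[of x] \<rho>_nonneg[of x] by (auto simp: less_le)
    ultimately have "\<rho> x * (u x - x) < 0"
      by (simp add: mult_pos_neg)
    then show ?thesis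
      using that x eq by (auto simp: algebra_simps)
  qed auto
  \<comment> \<open>\<open>M\<close> is continuous and changes sign, so its zero set is nonempty and
    compact. Its extreme points become the two contact speeds.\<close>
  define Z where "Z = {x. M x = 0}"
  have Z_bounds: "y0 \<le> x" "x \<le> y1" if "x \<in> Z" for x
    by (rule ccontr, use antimono[of x y0] antimono[of y1 x] y0 y1 that in \<open>auto simp: Z_def\<close>)+
  have "y0 \<le> y1"
    using y0 y1 C(1)[of 0] by linarith
  have "Z \<noteq> {}"
    using IVT2'[of M y1 0 y0] y0 y1 \<open>y0 \<le> y1\<close> contM continuous_on_subset
    by (fastforce simp: Z_def)
  moreover have "closed Z"
    unfolding Z_def using contM by (intro closed_Collect_eq continuous_on_const)
  moreover have bdd: "bdd_below Z" "bdd_above Z"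
    using Z_bounds by (auto simp: bdd_below_def bdd_above_def)
  ultimately have Z_in: "Inf Z \<in> Z" "Sup Z \<in> Z"
    by (auto intro: closed_contains_Inf closed_contains_Sup)
  define c1 c2 where "c1 = Inf Z" and "c2 = Sup Z"
  have Mc: "M c1 = 0" "M c2 = 0"
    using Z_in by (auto simp: Z_def c1_def c2_def)
  have less: "M x \<noteq> 0" if "x < c1" for x
    using cInf_lower[OF _ bdd(1), of x] that by (auto simp: Z_def c1_def)
  have greater: "M x \<noteq> 0" if "c2 < x" for x
    using cSup_upper[OF _ bdd(2), of x] that by (auto simp: Z_def c2_def)
  have "c1 \<le> c2"
    using Z_in bdd by (auto simp: c1_def c2_def intro: cInf_lower)
  note const = self_similar_constant_state[OF _ _ C(1) M contM Q contQ AE_M AE_Q]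
  obtain c K1 where 1: "c \<notin> {..<c1}" "\<And>x. x \<in> {..<c1} \<Longrightarrow> M x = K1 * (c - x)"
      "AE x in lborel. x \<in> {..<c1} \<longrightarrow> \<rho> x = K1 \<and> u x = c"
    by (rule const[of "{..<c1}"]) (use less in auto)
  have "K1 \<noteq> 0"
    using 1(2)[of "c1 - 1"] less[of "c1 - 1"] by auto
  \<comment> \<open>Continuity carries the linear formula to the endpoint, where \<open>M\<close>
    vanishes. As \<open>K1 \<noteq> 0\<close>, the constant velocity must equal
    \<open>c1\<close>.\<close>
  have "M c1 - K1 * (c - c1) = 0"
  proof (rule continuous_constant_on_closure[where S = "{..<c1}" and f = "\<lambda>x. M x - K1 * (c - x)"])
    show "continuous_on (closure {..<c1}) (\<lambda>x. M x - K1 * (c - x))"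
      by (intro continuous_intros continuous_on_subset[OF contM]) auto
  qed (use 1(2) in auto)
  then have "c = c1"
    using Mc \<open>K1 \<noteq> 0\<close> by auto
  obtain d K2 where 2: "d \<notin> {c2<..}" "\<And>x. x \<in> {c2<..} \<Longrightarrow> M x = K2 * (d - x)"
      "AE x in lborel. x \<in> {c2<..} \<longrightarrow> \<rho> x = K2 \<and> u x = d"
    by (rule const[of "{c2<..}"]) (use greater in auto)
  have "K2 \<noteq> 0"
    using 2(2)[of "c2 + 1"] greater[of "c2 + 1"] by auto
  have "M c2 - K2 * (d - c2) = 0"
  proof (rule continuous_constant_on_closure[where S = "{c2<..}" and f = "\<lambda>x. M x - K2 * (d - x)"])
    show "continuous_on (closure {c2<..}) (\<lambda>x. M x - K2 * (d - x))"
      by (intro continuous_intros continuous_on_subset[OF contM]) auto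
  qed (use 2(2) in auto)
  then have "d = c2"
    using Mc \<open>K2 \<noteq> 0\<close> by auto
  \<comment> \<open>\<open>M\<close> is 0 at both ends, so the nonnegative density integrates to 0
    in between; the vacuum convention then fixes the velocity.\<close>
  have "AE x in lborel. \<rho> x * indicator {c1<..c2} x = 0"
  proof (subst integral_nonneg_eq_0_iff_AE[symmetric])
    show "integrable lborel (\<lambda>x. \<rho> x * indicator {c1<..c2} x)"
      "(LINT x|lborel. \<rho> x * indicator {c1<..c2} x) = 0"
      using lborel_integral_Ioc(2,3)[OF meas(1) C(1), of c1 c2] M[OF \<open>c1 \<le> c2\<close>] Mc by auto
  qed (use \<rho>_nonneg in auto)
  then have mid: "AE x in lborel. c1 < x \<and> x < c2 \<longrightarrow> \<rho> x = 0 \<and> u x = x"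
    by eventually_elim (use vac in \<open>auto simp: indicator_def\<close>)
  show ?thesis
    by (rule that[OF \<open>c1 \<le> c2\<close> \<open>K1 \<noteq> 0\<close> \<open>K2 \<noteq> 0\<close> _ mid])
      (use 1(3) 2(3) \<open>c = c1\<close> \<open>d = c2\<close> in auto)
qed

section \<open>Identification of the constants from the initial data\<close>

text \<open>The explicit two-contact profile with states \<open>a'\<close> and \<open>b'\<close>
  agrees almost everywhere with the given one, so it inherits the data \<open>a\<close>,
  \<open>b\<close>; by construction it also has the data \<open>a'\<close>, \<open>b'\<close>. The
  general pair \<open>w\<close>, \<open>f\<close> serves both the mass and the momentum
  equation.\<close>

lemma two_contacts_unique:
  fixes w f :: "real \<Rightarrow> real"
  assumes sol: "weak_solution (\<lambda>x t. w (x / t)) (\<lambda>x t. f (x / t)) (\<lambda>x. if x < 0 then a else b)"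
    and meas: "w \<in> borel_measurable borel" "f \<in> borel_measurable borel"
    and bdd: "\<And>x. \<bar>w x\<bar> \<le> C" "\<And>x. \<bar>f x\<bar> \<le> C"
    and "c1 \<le> c2"
    and AE: "AE x in lborel. x < c1 \<longrightarrow> w x = a' \<and> f x = a' * c1"
      "AE x in lborel. c1 < x \<and> x < c2 \<longrightarrow> w x = 0 \<and> f x = 0"
      "AE x in lborel. c2 < x \<longrightarrow> w x = b' \<and> f x = b' * c2"
  shows "a' = a" "b' = b"
proof -
  define W where "W \<xi> = (if \<xi> \<le> c1 then a' else if \<xi> < c2 then 0 else b')" for \<xi> :: real
  define F where "F \<xi> = (if \<xi> \<le> c1 then a' * c1 else if \<xi> < c2 then 0 else b' * c2)" for \<xi> :: real
  have [measurable]: "W \<in> borel_measurable borel" "F \<in> borel_measurable borel"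
    unfolding W_def[abs_def] F_def[abs_def] by measurable
  define D where "D = \<bar>a'\<bar> + \<bar>b'\<bar> + \<bar>a' * c1\<bar> + \<bar>b' * c2\<bar>"
  have D: "\<bar>W x\<bar> \<le> D" "\<bar>F x\<bar> \<le> D" for x
    by (auto simp: W_def F_def D_def)
  have "AE x in lborel. w x = W x \<and> f x = F x"
    using AE AE_lborel_singleton[of c1] AE_lborel_singleton[of c2]
    by eventually_elim (use \<open>c1 \<le> c2\<close> in \<open>auto simp: W_def F_def\<close>)
  from weak_solution_AE_cong[OF meas _ _ bdd D this sol]
  have "weak_solution (\<lambda>x t. W (x / t)) (\<lambda>x t. F (x / t)) (\<lambda>x. if x < 0 then a else b)"
    by simp
  moreover have "weak_solution (\<lambda>x t. W (x / t)) (\<lambda>x t. F (x / t)) (\<lambda>x. if x < 0 then a' else b')"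
    by (rule two_contacts_weak_solution[OF \<open>c1 \<le> c2\<close>]) (auto simp: W_def F_def)
  ultimately show "a' = a" "b' = b"
    using weak_solution_initial_unique by metis+
qed

lemma transport_riemann_solution_vacuum:
  assumes "0 < \<rho>m" "0 < \<rho>p" "um < up"
  shows "transport_riemann_solution \<rho>m um \<rho>p up (vacuum_density \<rho>m um \<rho>p up) (vacuum_velocity um up)"
  unfolding transport_riemann_solution_def
proof (intro conjI allI impI)
  show "vacuum_density \<rho>m um \<rho>p up \<in> borel_measurable borel" "vacuum_velocity um up \<in> borel_measurable borel"
    unfolding vacuum_density_def[abs_def] vacuum_velocity_def[abs_def] by measurable
  show "bounded (range (vacuum_density \<rho>m um \<rho>p up))"
    unfolding bounded_iff using assms
    by (intro exI[of _ "\<rho>m + \<rho>p"]) (auto simp: vacuum_density_def)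
  show "bounded (range (vacuum_velocity um up))"
    unfolding bounded_iff
    by (intro exI[of _ "\<bar>um\<bar> + \<bar>up\<bar>"]) (auto simp: vacuum_velocity_def)
  show "0 \<le> vacuum_density \<rho>m um \<rho>p up \<xi>" for \<xi>
    using assms by (simp add: vacuum_density_def)
  show "vacuum_velocity um up \<xi> = \<xi>" if "vacuum_density \<rho>m um \<rho>p up \<xi> = 0" for \<xi>
    using that assms by (auto simp: vacuum_density_def vacuum_velocity_def split: if_splits)
  show "weak_solution (\<lambda>x t. vacuum_density \<rho>m um \<rho>p up (x / t))
      (\<lambda>x t. vacuum_density \<rho>m um \<rho>p up (x / t) * vacuum_velocity um up (x / t))
      (\<lambda>x. if x < 0 then \<rho>m else \<rho>p)"
    by (rule two_contacts_weak_solution[of um up _ _ _ "\<lambda>\<xi>. vacuum_density \<rho>m um \<rho>p up \<xi> * vacuum_velocity um up \<xi>"])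
      (use assms in \<open>auto simp: vacuum_density_def vacuum_velocity_def\<close>)
  \<comment> \<open>The same two-contact pattern, now with the momenta \<open>\<rho>m * um\<close>
    and \<open>\<rho>p * up\<close> as carried states.\<close>
  show "weak_solution (\<lambda>x t. vacuum_density \<rho>m um \<rho>p up (x / t) * vacuum_velocity um up (x / t))
      (\<lambda>x t. vacuum_density \<rho>m um \<rho>p up (x / t) * (vacuum_velocity um up (x / t))\<^sup>2)
      (\<lambda>x. if x < 0 then \<rho>m * um else \<rho>p * up)"
    by (rule two_contacts_weak_solution[of um up
          "\<lambda>\<xi>. vacuum_density \<rho>m um \<rho>p up \<xi> * vacuum_velocity um up \<xi>" _ _
          "\<lambda>\<xi>. vacuum_density \<rho>m um \<rho>p up \<xi> * (vacuum_velocity um up \<xi>)\<^sup>2"])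
      (use assms in \<open>auto simp: vacuum_density_def vacuum_velocity_def power2_eq_square\<close>)
qed

text \<open>The mass equation identifies \<open>K1\<close> and \<open>K2\<close> with the given
  densities. The momentum equation then gives \<open>K1 * c1 = \<rho>m * um\<close> and
  \<open>K2 * c2 = \<rho>p * up\<close>, and cancelling the nonzero densities yields the
  speeds.\<close>

lemma transport_riemann_solution_unique:
  assumes sol: "transport_riemann_solution \<rho>m um \<rho>p up \<rho> u"
  shows "AE \<xi> in lborel. \<rho> \<xi> = vacuum_density \<rho>m um \<rho>p up \<xi> \<and> u \<xi> = vacuum_velocity um up \<xi>"
proof -
  obtain c1 c2 K1 K2 where c: "c1 \<le> c2" and K: "K1 \<noteq> 0" "K2 \<noteq> 0"
    and AE: "AE x in lborel. x < c1 \<longrightarrow> \<rho> x = K1 \<and> u x = c1"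
    "AE x in lborel. c1 < x \<and> x < c2 \<longrightarrow> \<rho> x = 0 \<and> u x = x"
    "AE x in lborel. c2 < x \<longrightarrow> \<rho> x = K2 \<and> u x = c2"
    by (rule transport_riemann_solution_structure[OF sol]) blast
  have [measurable]: "\<rho> \<in> borel_measurable borel" "u \<in> borel_measurable borel"
    and weak1: "weak_solution (\<lambda>x t. \<rho> (x / t)) (\<lambda>x t. \<rho> (x / t) * u (x / t)) (\<lambda>x. if x < 0 then \<rho>m else \<rho>p)"
    and weak2: "weak_solution (\<lambda>x t. \<rho> (x / t) * u (x / t)) (\<lambda>x t. \<rho> (x / t) * (u (x / t))\<^sup>2)
      (\<lambda>x. if x < 0 then \<rho>m * um else \<rho>p * up)"
    using sol unfolding transport_riemann_solution_def by blast+
  obtain C where C: "\<And>x. \<bar>\<rho> x\<bar> \<le> C" "\<And>x. \<bar>u x\<bar> \<le> C" "\<And>x. \<bar>\<rho> x * u x\<bar> \<le> C"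
      "\<And>x. \<bar>\<rho> x * (u x)\<^sup>2\<bar> \<le> C"
    by (rule transport_riemann_solution_bounds[OF sol]) blast
  have "AE x in lborel. x < c1 \<longrightarrow> \<rho> x = K1 \<and> \<rho> x * u x = K1 * c1"
    "AE x in lborel. c1 < x \<and> x < c2 \<longrightarrow> \<rho> x = 0 \<and> \<rho> x * u x = 0"
    "AE x in lborel. c2 < x \<longrightarrow> \<rho> x = K2 \<and> \<rho> x * u x = K2 * c2"
    by (rule AE_mp[OF AE(1)], simp) (rule AE_mp[OF AE(2)], simp, rule AE_mp[OF AE(3)], simp)
  from two_contacts_unique[OF weak1 _ _ C(1,3) c this]
  have K_eq: "K1 = \<rho>m" "K2 = \<rho>p"
    by auto
  have "AE x in lborel. x < c1 \<longrightarrow> \<rho> x * u x = K1 * c1 \<and> \<rho> x * (u x)\<^sup>2 = K1 * c1 * c1"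
    "AE x in lborel. c1 < x \<and> x < c2 \<longrightarrow> \<rho> x * u x = 0 \<and> \<rho> x * (u x)\<^sup>2 = 0"
    "AE x in lborel. c2 < x \<longrightarrow> \<rho> x * u x = K2 * c2 \<and> \<rho> x * (u x)\<^sup>2 = K2 * c2 * c2"
    by (rule AE_mp[OF AE(1)], simp add: power2_eq_square)
      (rule AE_mp[OF AE(2)], simp, rule AE_mp[OF AE(3)], simp add: power2_eq_square)
  from two_contacts_unique[OF weak2 _ _ C(3,4) c this]
  have "K1 * c1 = \<rho>m * um" "K2 * c2 = \<rho>p * up"
    by auto
  then have c_eq: "c1 = um" "c2 = up"
    using K K_eq by auto
  show ?thesis
    using AE AE_lborel_singleton[of c1] AE_lborel_singleton[of c2]
    by eventually_elim
      (use c in \<open>auto simp: vacuum_density_def vacuum_velocity_def K_eq c_eq\<close>)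
qed

theorem theorem4p2:
  fixes n \<alpha> \<rho>m \<rho>p um up :: real
    and \<rho> u :: "real \<Rightarrow> real \<Rightarrow> real \<Rightarrow> real"
  assumes "1 \<le> n" and "n \<le> 3" and "0 < \<alpha>" and "\<alpha> \<le> 1"
    and "\<rho>m > 0" and "\<rho>p > 0" and "um < up"
    and "\<And>A B. A > 0 \<Longrightarrow> B > 0 \<Longrightarrow> (\<rho>p, up) \<in> R1R2 n \<alpha> A B \<rho>m um \<Longrightarrow>
           two_rarefaction_solution n \<alpha> A B \<rho>m um \<rho>p up (\<rho> A B) (u A B)"
  shows "(\<forall>\<xi>. \<xi> \<noteq> um \<and> \<xi> \<noteq> up \<longrightarrow>
            ((\<lambda>(A, B). \<rho> A B \<xi>) \<longlongrightarrow> vacuum_density \<rho>m um \<rho>p up \<xi>)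
              (at (0, 0) within {0<..} \<times> {0<..}) \<and>
            ((\<lambda>(A, B). \<rho> A B \<xi> * u A B \<xi>) \<longlongrightarrow>
                vacuum_density \<rho>m um \<rho>p up \<xi> * vacuum_velocity um up \<xi>)
              (at (0, 0) within {0<..} \<times> {0<..}) \<and>
            (vacuum_density \<rho>m um \<rho>p up \<xi> \<noteq> 0 \<longrightarrow>
              ((\<lambda>(A, B). u A B \<xi>) \<longlongrightarrow> vacuum_velocity um up \<xi>)
                (at (0, 0) within {0<..} \<times> {0<..})))
       \<and> transport_riemann_solution \<rho>m um \<rho>p up
            (vacuum_density \<rho>m um \<rho>p up) (vacuum_velocity um up)
       \<and> (\<forall>\<rho>' u'. transport_riemann_solution \<rho>m um \<rho>p up \<rho>' u' \<longrightarrow>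
            (AE \<xi> in lborel. \<rho>' \<xi> = vacuum_density \<rho>m um \<rho>p up \<xi> \<and>
                             u' \<xi> = vacuum_velocity um up \<xi>))"
proof (intro conjI allI impI)
  \<comment> \<open>The profiles are assumed to be solutions only when the right state lies in the
    region; for small \<open>A\<close> and \<open>B\<close> this always holds.\<close>
  have sol: "\<forall>\<^sub>F (A, B) in small_parameters.
      two_rarefaction_solution n \<alpha> A B \<rho>m um \<rho>p up (\<rho> A B) (u A B)"
    using eventually_R1R2[of n \<alpha> \<rho>m \<rho>p um up] eventually_small_parameters_pos
    by (rule eventually_elim2) (use assms in auto)
  fix \<xi>
  assume \<xi>: "\<xi> \<noteq> um \<and> \<xi> \<noteq> up"
  have "0 \<le> \<alpha>"
    using assms(3) by simp
  note lim = two_rarefaction_limit[OF assms(1) this assms(5,6) sol assms(7), of \<xi>]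
  show "((\<lambda>(A, B). \<rho> A B \<xi>) \<longlongrightarrow> vacuum_density \<rho>m um \<rho>p up \<xi>) small_parameters"
    using \<xi> by (intro lim(1)) auto
  show "((\<lambda>(A, B). \<rho> A B \<xi> * u A B \<xi>) \<longlongrightarrow>
      vacuum_density \<rho>m um \<rho>p up \<xi> * vacuum_velocity um up \<xi>) small_parameters"
    using \<xi> by (intro lim(2)) auto
  show "((\<lambda>(A, B). u A B \<xi>) \<longlongrightarrow> vacuum_velocity um up \<xi>) small_parameters"
    if "vacuum_density \<rho>m um \<rho>p up \<xi> \<noteq> 0"
    using \<xi> that by (intro lim(3)) auto
next
  show "transport_riemann_solution \<rho>m um \<rho>p up
      (vacuum_density \<rho>m um \<rho>p up) (vacuum_velocity um up)"
    using assms(5-7) by (rule transport_riemann_solution_vacuum)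
next
  fix \<rho>' u'
  assume "transport_riemann_solution \<rho>m um \<rho>p up \<rho>' u'"
  then show "AE \<xi> in lborel. \<rho>' \<xi> = vacuum_density \<rho>m um \<rho>p up \<xi> \<and>
      u' \<xi> = vacuum_velocity um up \<xi>"
    by (rule transport_riemann_solution_unique)
qed

end
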